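(* Let $C$ be a rectilinear polygon with $T\ge 0$ reflex vertices, let $n\ge 1$, and let $V_1,\dots,V_n$ be value-measures on $C$. Then there exist $n$ pairwise interior-disjoint rectangles $Z_1,\dots,Z_n\subseteq C$ such that $$V_i(Z_i)\ \ge\ \frac{1}{n+T}\,V_i(C)\qquad\text{for all } i\in\{1,\dots,n\}.$$
   Context: A rectilinear polygon is a polygon in the plane (including its interior) all of whose internal angles are $90^\circ$ or $270^\circ$. A reflex vertex is a vertex with internal angle $270^\circ$. A value-measure on $C$ is a function of the form $V(Z)=\int_Z v(x)\,dx$ for (measurable) $Z\subseteq C$, where $v:C\to\mathbb{R}_{\ge0}$ is integrable with respect to the two-dimensional Lebesgue measure. Parts of $C$ may remain unallocated. *)

theory Defs
  imports "HOL-Analysis.Analysis"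
begin

text \<open>
  The plane is the type \<^typ>\<open>complex\<close>. A polygon is given by the cyclic list of its vertices,
  which may be listed in either orientation.
\<close>

definition next_vertex :: "complex list \<Rightarrow> nat \<Rightarrow> complex" where
  "next_vertex ps k = ps ! ((k + 1) mod length ps)"

definition prev_vertex :: "complex list \<Rightarrow> nat \<Rightarrow> complex" where
  "prev_vertex ps k = ps ! ((k + length ps - 1) mod length ps)"

definition polygon_edge :: "complex list \<Rightarrow> nat \<Rightarrow> complex set" where
  "polygon_edge ps k = closed_segment (ps ! k) (next_vertex ps k)"

definition polygon_boundary :: "complex list \<Rightarrow> complex set" where
  "polygon_boundary ps = (\<Union>k<length ps. polygon_edge ps k)"

definition polygon_region :: "complex list \<Rightarrow> complex set" where
  "polygon_region ps = polygon_boundary ps \<union> inside (polygon_boundary ps)"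

definition simple_polygon :: "complex list \<Rightarrow> bool" where
  "simple_polygon ps \<longleftrightarrow>
     length ps \<ge> 3 \<and> distinct ps \<and>
     (\<forall>k<length ps. polygon_edge ps k \<inter> polygon_edge ps ((k + 1) mod length ps)
                      = {next_vertex ps k}) \<and>
     (\<forall>j<length ps. \<forall>k<length ps.
        j \<noteq> k \<and> k \<noteq> (j + 1) mod length ps \<and> j \<noteq> (k + 1) mod length ps \<longrightarrow>
        polygon_edge ps j \<inter> polygon_edge ps k = {})"

text \<open>
  The two sides meeting at a vertex \<open>p\<close> bound two angular sectors. If \<open>\<theta>\<close> is the
  counterclockwise angle from the side towards the next vertex to the side towards the previous
  one, the sectors have angles \<open>\<theta>\<close> and \<open>2 * pi - \<theta>\<close>. The internal angle is the angle of the
  sector that, near \<open>p\<close>, lies in the polygon; so it does not depend on the orientation of the list.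
\<close>

definition internal_angle :: "complex list \<Rightarrow> nat \<Rightarrow> real" where
  "internal_angle ps k =
     (let p = ps ! k;
          a = next_vertex ps k - p;
          b = prev_vertex ps k - p;
          \<theta> = Arg2pi (b / a)
      in if \<exists>\<epsilon>>0. \<forall>r\<in>{0<..<\<epsilon>}. \<forall>t\<in>{0<..<\<theta>}. p + of_real r * cis t * a \<in> polygon_region ps
         then \<theta> else 2 * pi - \<theta>)"

definition rectilinear_polygon :: "complex list \<Rightarrow> bool" where
  "rectilinear_polygon ps \<longleftrightarrow>
     simple_polygon ps \<and> (\<forall>k<length ps. internal_angle ps k \<in> {pi / 2, 3 * pi / 2})"

definition reflex_vertices :: "complex list \<Rightarrow> complex set" where
  "reflex_vertices ps = {ps ! k | k. k < length ps \<and> internal_angle ps k = 3 * pi / 2}"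

text \<open>Closed, nondegenerate rectangles of arbitrary orientation.\<close>

definition rectangle :: "complex set \<Rightarrow> bool" where
  "rectangle Z \<longleftrightarrow>
     (\<exists>c u w h. norm u = 1 \<and> w > 0 \<and> h > 0 \<and> Z = (\<lambda>z. c + u * z) ` cbox 0 (Complex w h))"

definition value_measure :: "complex set \<Rightarrow> (complex set \<Rightarrow> real) \<Rightarrow> bool" where
  "value_measure C V \<longleftrightarrow>
     (\<exists>v. (\<forall>x\<in>C. 0 \<le> v x) \<and> set_integrable lebesgue C v \<and>
          (\<forall>Z\<in>sets lebesgue. Z \<subseteq> C \<longrightarrow> V Z = (LINT x:Z|lebesgue. v x)))"

end

theory Submission imports Defs begin

text \<open>
  The polygon is cut into at most \<open>T + 1\<close> rectangles, and the rectangles are then divided like a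
  cake that comes in several pieces.

  \<^emph>\<open>Cutting.\<close> All sides have one of two perpendicular directions; turn the picture so that these
  are horizontal and vertical. Call a maximal horizontal segment in the interior of the polygon a
  chord. An end of a chord either lies in the relative interior of a vertical side or is a reflex
  vertex: one of the two sides at such a vertex continues the chord, so three of the four quadrants
  around the vertex are not separated from each other by the boundary; the chord runs through their
  union, which therefore lies in the interior
  (\<open>chord_end_clean_or_reflex\<close>). Cut along all chords that have a reflex end. A reflex vertex ends
  only one chord, as one of its two sides is horizontal, so there are at most \<open>T\<close> cuts.

  What remains falls apart into open rectangles (\<open>component_is_box\<close>): a chord with no reflex end
  keeps its two abscissae when it is moved slightly up or down, so the abscissae are locally
  constant off the cuts and hence constant on each component. The number of components comes from a
  graph whose nodes are the components and whose edges are the cuts, each joining the component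
  just above it to the one just below. The graph is connected because the interior of a Jordan
  curve is, so it has at most one node more than edges (\<open>spanning_count\<close>). Thus connectedness of
  the interior replaces the usual angle count.

  \<^emph>\<open>Dividing.\<close> If \<open>n\<close> agents share \<open>m\<close> rectangles, each agent can get a part of one rectangle
  worth \<open>1 / (n + m - 1)\<close> of the total (\<open>multicake_division\<close>). Move a knife over a rectangle and
  stop when somebody values the part passed at one share: either this agent leaves with that part,
  or nobody stops the knife and the whole rectangle is discarded. Every remaining agent loses at
  most one share, while \<open>n + m\<close> drops by one. With \<open>m \<le> T + 1\<close> this is the required bound.
\<close>

section \<open>Connected graphs\<close>

text \<open>
  The hypothesis on \<open>S\<close> is connectedness of the multigraph with nodes \<open>V\<close> and edges \<open>E\<close>. A largest
  set of nodes that spans at least as many edges as its size minus one is closed under adjacency: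
  otherwise some edge leaves it, and adding the other end of that edge enlarges the set by one node
  and at least one edge.
\<close>
lemma spanning_count:
  fixes up dn :: "'c \<Rightarrow> 'v"
  assumes "finite E" and ends: "\<And>c. c \<in> E \<Longrightarrow> up c \<in> V \<and> dn c \<in> V"
    and conn: "\<And>S. S \<subseteq> V \<Longrightarrow> (\<And>c. c \<in> E \<Longrightarrow> up c \<in> S \<longleftrightarrow> dn c \<in> S) \<Longrightarrow> S = {} \<or> S = V"
  shows "finite V \<and> card V \<le> card E + 1"
proof (cases "V = {}")
  case True
  then show ?thesis by simp
next
  case False
  then obtain v where v: "v \<in> V" by blast
  define good where "good S \<longleftrightarrow> S \<noteq> {} \<and> S \<subseteq> V \<and> finite S \<and>
    card S \<le> card {c \<in> E. up c \<in> S \<and> dn c \<in> S} + 1" for S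
  have bound: "card S < card E + 2" if "good S" for S
  proof -
    have "card {c \<in> E. up c \<in> S \<and> dn c \<in> S} \<le> card E"
      using \<open>finite E\<close> by (intro card_mono) auto
    with that show ?thesis unfolding good_def by linarith
  qed
  have "good {v}" using v by (simp add: good_def)
  then obtain S where S: "good S" and max: "\<And>S'. good S' \<Longrightarrow> card S' \<le> card S"
    using ex_has_greatest_nat[of good "{v}" card "card E + 2"] bound by (metis less_imp_le)
  have "S = V"
  proof (rule ccontr)
    assume "S \<noteq> V"
    have "S \<subseteq> V" "S \<noteq> {}" "finite S" using S by (auto simp: good_def)
    with conn[of S] \<open>S \<noteq> V\<close> obtain c where c: "c \<in> E" "up c \<in> S \<longleftrightarrow> dn c \<notin> S" by blast
    define w where "w = (if up c \<in> S then dn c else up c)"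
    have w: "w \<notin> S" "w \<in> V" using c ends[of c] by (auto simp: w_def)
    let ?I = "\<lambda>S. {c \<in> E. up c \<in> S \<and> dn c \<in> S}"
    have "insert c (?I S) \<subseteq> ?I (insert w S)" using c by (auto simp: w_def)
    then have "card (insert c (?I S)) \<le> card (?I (insert w S))"
      using \<open>finite E\<close> by (intro card_mono) auto
    moreover have "c \<notin> ?I S" using c by auto
    ultimately have "card (?I S) + 1 \<le> card (?I (insert w S))"
      using \<open>finite E\<close> by simp
    then have "good (insert w S)" using S w by (auto simp: good_def)
    from max[OF this] w \<open>finite S\<close> show False by simp
  qed
  with S bound[OF S] show ?thesis by (auto simp: good_def)
qed

section \<open>Moving knives on several cakes\<close>

text \<open>
  The cake \<open>j\<close> is the interval from \<open>a j\<close> to \<open>b j\<close>, and \<open>F i j\<close> is a primitive of the value density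
  of agent \<open>i\<close> on it. The proof is by induction on the number of agents plus the number of cakes,
  with the left ends \<open>a\<close> variable: serving an agent shortens one cake from the left.
\<close>
lemma multicake_division:
  fixes F :: "'i \<Rightarrow> 'j \<Rightarrow> real \<Rightarrow> real" and a b :: "'j \<Rightarrow> real" and w :: "'i \<Rightarrow> real"
  assumes "finite N" "finite J" "N \<noteq> {} \<Longrightarrow> J \<noteq> {}"
    and "\<And>j. j \<in> J \<Longrightarrow> a j \<le> b j"
    and "\<And>i j. i \<in> N \<Longrightarrow> j \<in> J \<Longrightarrow> continuous_on UNIV (F i j)"
    and "\<And>i j. i \<in> N \<Longrightarrow> j \<in> J \<Longrightarrow> mono (F i j)"
    and "\<And>i. i \<in> N \<Longrightarrow> w i > 0"
    and "\<And>i. i \<in> N \<Longrightarrow> (\<Sum>j\<in>J. F i j (b j) - F i j (a j)) \<ge> (real (card N) + real (card J) - 1) * w i"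
  shows "\<exists>c s t. (\<forall>i\<in>N. c i \<in> J \<and> a (c i) \<le> s i \<and> s i < t i \<and> t i \<le> b (c i) \<and>
             F i (c i) (t i) - F i (c i) (s i) \<ge> w i) \<and>
           (\<forall>i\<in>N. \<forall>i'\<in>N. i \<noteq> i' \<longrightarrow> c i = c i' \<longrightarrow> t i \<le> s i' \<or> t i' \<le> s i)"
  using assms
proof (induction "card N + card J" arbitrary: N J a rule: less_induct)
  case (less N J a)
  note fin = less.prems(1,2) and ne = less.prems(3) and ab = less.prems(4) and cont = less.prems(5)
    and mon = less.prems(6) and pos = less.prems(7) and val = less.prems(8)
  show ?case
  proof (cases "N = {}")
    case True
    then show ?thesis by simp
  next
    case False
    then obtain j where j: "j \<in> J" using ne by blast
    have Jcard: "card J = card (J - {j}) + 1" using j fin by (metis Suc_eq_plus1 card.remove)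
    have Jsum: "(\<Sum>k\<in>J. f k) = f j + (\<Sum>k\<in>J - {j}. f k)" for f :: "'j \<Rightarrow> real"
      using j fin by (simp add: sum.remove)
    define g where "g i x = F i j x - F i j (a j)" for i x
    have gmono: "g i x \<le> g i y" if "x \<le> y" "i \<in> N" for i x y
      using mon[OF that(2) j] that by (auto simp: g_def mono_def)
    \<comment> \<open>If every agent values cake \<open>j\<close> below one share, the cake is thrown away.\<close>
    show ?thesis
    proof (cases "\<exists>i\<in>N. g i (b j) \<ge> w i")
      case False
      then have small: "g i (b j) < w i" if "i \<in> N" for i using that by force
      obtain i0 where i0: "i0 \<in> N" using \<open>N \<noteq> {}\<close> by blast
      \<comment> \<open>A single cake is never thrown away, since it is worth at least as many shares as there are agents.\<close>
      have J': "J - {j} \<noteq> {}"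
      proof
        assume e: "J - {j} = {}"
        have "card J = 1" using Jcard e by (metis add_0 card.empty)
        then have "(real (card N) + real (card J) - 1) * w i0 = real (card N) * w i0" by simp
        with val[OF i0] have "real (card N) * w i0 \<le> g i0 (b j)" unfolding Jsum e by (simp add: g_def)
        moreover have "real (card N) \<ge> 1" using i0 fin by (metis One_nat_def Suc_leI card_gt_0_iff empty_iff of_nat_1 of_nat_mono)
        then have "1 * w i0 \<le> real (card N) * w i0" using pos[OF i0] by (intro mult_right_mono) auto
        ultimately show False using small[OF i0] by linarith
      qed
      have "\<exists>c s t. (\<forall>i\<in>N. c i \<in> J - {j} \<and> a (c i) \<le> s i \<and> s i < t i \<and> t i \<le> b (c i) \<and>
             F i (c i) (t i) - F i (c i) (s i) \<ge> w i) \<and>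
           (\<forall>i\<in>N. \<forall>i'\<in>N. i \<noteq> i' \<longrightarrow> c i = c i' \<longrightarrow> t i \<le> s i' \<or> t i' \<le> s i)"
      proof (rule less.hyps)
        show "card N + card (J - {j}) < card N + card J" using Jcard by simp
        fix i assume i: "i \<in> N"
        show "(real (card N) + real (card (J - {j})) - 1) * w i \<le> (\<Sum>j\<in>J - {j}. F i j (b j) - F i j (a j))"
          using val[OF i] small[OF i] Jcard unfolding Jsum g_def by (simp add: algebra_simps)
      qed (use fin ab cont mon pos J' in auto)
      then show ?thesis by (metis Diff_iff)
    next
      case True
      \<comment> \<open>The agents in \<open>M\<close> stop the knife at \<open>X i\<close>; the first of them is served.\<close>
      define M where "M = {i \<in> N. g i (b j) \<ge> w i}"
      have "M \<noteq> {}" "finite M" using True fin by (auto simp: M_def)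
      have "\<exists>x. a j \<le> x \<and> x \<le> b j \<and> g i x = w i" if "i \<in> M" for i
      proof -
        have i: "i \<in> N" "w i \<le> g i (b j)" using that by (auto simp: M_def)
        have "continuous_on {a j..b j} (g i)" unfolding g_def
          by (intro continuous_intros continuous_on_subset[OF cont[OF i(1) j]]) auto
        moreover have "g i (a j) \<le> w i" using pos[OF i(1)] by (simp add: g_def)
        ultimately show ?thesis using i IVT'[of "g i" "a j" "w i" "b j"] ab[OF j] by blast
      qed
      then obtain X where X: "\<And>i. i \<in> M \<Longrightarrow> a j \<le> X i \<and> X i \<le> b j \<and> g i (X i) = w i" by metis
      obtain m where m: "m \<in> M" and least: "\<And>i. i \<in> M \<Longrightarrow> X m \<le> X i"
        using \<open>M \<noteq> {}\<close> \<open>finite M\<close> by (metis arg_min_if_finite(1) arg_min_least)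
      define x where "x = X m"
      have mN: "m \<in> N" using m by (simp add: M_def)
      have x: "a j \<le> x" "x \<le> b j" "g m x = w m" using X[OF m] by (auto simp: x_def)
      have "x \<noteq> a j" using x(3) pos[OF mN] by (auto simp: g_def)
      then have "a j < x" using x by simp
      have le: "g i x \<le> w i" if "i \<in> N" for i
      proof (cases "i \<in> M")
        case True
        then show ?thesis using gmono[OF least[OF True] that] X[OF True] by (simp add: x_def)
      next
        case False
        then show ?thesis using gmono[OF x(2) that] that by (auto simp: M_def)
      qed
      define a' where "a' = a(j := x)"
      have Ncard: "card N = card (N - {m}) + 1" using mN fin by (metis Suc_eq_plus1 card.remove)
      have "\<exists>c s t. (\<forall>i\<in>N - {m}. c i \<in> J \<and> a' (c i) \<le> s i \<and> s i < t i \<and> t i \<le> b (c i) \<and>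
             F i (c i) (t i) - F i (c i) (s i) \<ge> w i) \<and>
           (\<forall>i\<in>N - {m}. \<forall>i'\<in>N - {m}. i \<noteq> i' \<longrightarrow> c i = c i' \<longrightarrow> t i \<le> s i' \<or> t i' \<le> s i)"
      proof (rule less.hyps)
        show "card (N - {m}) + card J < card N + card J" using Ncard by simp
        show "\<And>k. k \<in> J \<Longrightarrow> a' k \<le> b k" using ab x by (auto simp: a'_def)
        fix i assume i: "i \<in> N - {m}"
        have "(\<Sum>k\<in>J. F i k (b k) - F i k (a k)) = g i x + (\<Sum>k\<in>J. F i k (b k) - F i k (a' k))"
          unfolding Jsum by (simp add: g_def a'_def)
        then show "(real (card (N - {m})) + real (card J) - 1) * w i
             \<le> (\<Sum>k\<in>J. F i k (b k) - F i k (a' k))"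
          using val[of i] le[of i] i Ncard by (simp add: algebra_simps)
      qed (use fin cont mon pos j in auto)
      then obtain c s t where AB:
        "(\<forall>i\<in>N - {m}. c i \<in> J \<and> a' (c i) \<le> s i \<and> s i < t i \<and> t i \<le> b (c i) \<and>
             F i (c i) (t i) - F i (c i) (s i) \<ge> w i) \<and>
         (\<forall>i\<in>N - {m}. \<forall>i'\<in>N - {m}. i \<noteq> i' \<longrightarrow> c i = c i' \<longrightarrow> t i \<le> s i' \<or> t i' \<le> s i)"
        by (elim exE)
      note A = bspec[OF AB[THEN conjunct1]]
      note B = AB[THEN conjunct2, rule_format]
      define c' where "c' = c(m := j)"
      define s' where "s' = s(m := a j)"
      define t' where "t' = t(m := x)"
      have 1: "c' i \<in> J \<and> a (c' i) \<le> s' i \<and> s' i < t' i \<and> t' i \<le> b (c' i) \<and>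
             F i (c' i) (t' i) - F i (c' i) (s' i) \<ge> w i" if "i \<in> N" for i
      proof (cases "i = m")
        case True
        then show ?thesis using x j \<open>a j < x\<close> by (simp add: c'_def s'_def t'_def g_def)
      next
        case False
        have "a (c i) \<le> a' (c i)" using x by (simp add: a'_def)
        then show ?thesis using False A[of i] that by (auto simp: c'_def s'_def t'_def)
      qed
      have 2: "t' i \<le> s' i' \<or> t' i' \<le> s' i" if "i \<in> N" "i' \<in> N" "i \<noteq> i'" "c' i = c' i'" for i i'
        using that A[of i] A[of i'] B[of i i']
        by (auto simp: c'_def s'_def t'_def a'_def split: if_splits)
      from 1 2 show ?thesis by blast
    qed
  qed
qed

section \<open>Cutting a plane domain along horizontal chords\<close>

text \<open>
  A triple \<open>(a, b, y)\<close> stands for the open horizontal segment at height \<open>y\<close> between the abscissae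
  \<open>a\<close> and \<open>b\<close>.
\<close>
definition hseg :: "real \<times> real \<times> real \<Rightarrow> complex set" where
  "hseg = (\<lambda>(a, b, y). {z. a < Re z \<and> Re z < b \<and> Im z = y})"

text \<open>
  Since the ends are outside \<open>U\<close>, these are the maximal horizontal segments in \<open>U\<close>.
\<close>
definition chord :: "complex set \<Rightarrow> real \<times> real \<times> real \<Rightarrow> bool" where
  "chord U = (\<lambda>(a, b, y). a < b \<and> hseg (a, b, y) \<subseteq> U \<and> Complex a y \<notin> U \<and> Complex b y \<notin> U)"

text \<open>
  Near \<open>q\<close> the vertical line through \<open>q\<close> is outside \<open>U\<close> and its side given by the sign \<open>\<sigma>\<close> is inside:
  the right side for \<open>\<sigma> = 1\<close>, as at the left end of a chord, and the left side for \<open>\<sigma> = -1\<close>.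
\<close>
definition clean_end :: "complex set \<Rightarrow> real \<Rightarrow> complex \<Rightarrow> bool" where
  "clean_end U \<sigma> q \<longleftrightarrow> (\<exists>\<delta>>0. \<forall>z. \<bar>Re z - Re q\<bar> < \<delta> \<longrightarrow> \<bar>Im z - Im q\<bar> < \<delta> \<longrightarrow>
     (\<sigma> * (Re z - Re q) > 0 \<longrightarrow> z \<in> U) \<and> (Re z = Re q \<longrightarrow> z \<notin> U))"

lemma mem_hseg [simp]: "z \<in> hseg (a, b, y) \<longleftrightarrow> a < Re z \<and> Re z < b \<and> Im z = y"
  by (simp add: hseg_def)

lemma convex_hseg: "convex (hseg c)"
proof -
  obtain a b y where c: "c = (a, b, y)" by (cases c)
  have "hseg c = {z. Re z > a} \<inter> {z. Re z < b} \<inter> {z. Im z = y}" by (auto simp: c)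
  moreover have "convex {z. Im z = y}"
    using convex_hyperplane[of \<i> y] by (simp add: inner_complex_def)
  ultimately show ?thesis
    by (simp add: convex_Int convex_halfspace_Re_gt convex_halfspace_Re_lt)
qed

lemma negligible_hseg: "negligible (hseg c)"
proof -
  obtain a b y where c: "c = (a, b, y)" by (cases c)
  have "hseg c \<subseteq> {z. \<i> \<bullet> z = y}" by (auto simp: c inner_complex_def)
  then show ?thesis using negligible_hyperplane[of \<i> y] negligible_subset by auto
qed

lemma chord_unique:
  assumes "chord U c" "chord U c'" "z \<in> hseg c" "z \<in> hseg c'"
  shows "c = c'"
proof -
  obtain a b y a' b' y' where c: "c = (a, b, y)" "c' = (a', b', y')" by (cases c, cases c') auto
  have z: "a < Re z" "Re z < b" "Im z = y" "a' < Re z" "Re z < b'" "y' = y"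
    using assms by (auto simp: c)
  have U: "Complex x y \<in> U" if "a < x \<and> x < b \<or> a' < x \<and> x < b'" for x
    using that assms(1,2) z by (auto simp: chord_def c subset_iff)
  have "Complex a y \<notin> U" "Complex b y \<notin> U" "Complex a' y \<notin> U" "Complex b' y \<notin> U"
    using assms(1,2) z by (auto simp: chord_def c)
  then have "\<not> (a' < a \<and> a < b')" "\<not> (a < a' \<and> a' < b)" "\<not> (a' < b \<and> b < b')" "\<not> (a < b' \<and> b' < b)"
    using U by blast+
  with z c show ?thesis by auto
qed

lemma chord_same_end:
  assumes "chord U (a, b, y)" "chord U (a', b', y)" "a = a' \<or> b = b'"
  shows "a = a' \<and> b = b'"
proof -
  define x where "x = (if a = a' then (a + min b b') / 2 else (b + max a a') / 2)"
  have "a < b" "a' < b'" using assms by (auto simp: chord_def)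
  then have "Complex x y \<in> hseg (a, b, y)" "Complex x y \<in> hseg (a', b', y)"
    using assms(3) by (auto simp: x_def min_def max_def)
  from chord_unique[OF assms(1,2) this] show ?thesis by simp
qed

lemma chord_exists:
  assumes "open U" "bounded U" "z \<in> U"
  obtains a b where "chord U (a, b, Im z)" "z \<in> hseg (a, b, Im z)"
proof -
  define L where "L = (\<lambda>x. Complex x (Im z)) -` (- U)"
  have "continuous_on UNIV (\<lambda>x. Complex x (Im z))"
    unfolding Complex_eq by (intro continuous_intros)
  moreover have "closed (- U)" using assms(1) by (simp add: closed_Compl)
  ultimately have "closed L" unfolding L_def by (metis closed_vimage)
  obtain M where M: "\<And>w. w \<in> U \<Longrightarrow> norm w \<le> M" using assms(2) bounded_iff by blast
  have out: "x \<in> L" if "\<bar>x\<bar> > M" for x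
    using M[of "Complex x (Im z)"] that abs_Re_le_cmod[of "Complex x (Im z)"] by (auto simp: L_def)
  have zM: "\<bar>Re z\<bar> \<le> M" using M[OF assms(3)] abs_Re_le_cmod[of z] by linarith
  define b where "b = Inf (L \<inter> {Re z..})"
  have B: "closed (L \<inter> {Re z..})" "L \<inter> {Re z..} \<noteq> {}" "bdd_below (L \<inter> {Re z..})"
    using \<open>closed L\<close> out[of "M + 1"] zM by (auto intro!: exI[of _ "M + 1"])
  have b: "b \<in> L" "Re z \<le> b" using closed_contains_Inf[OF B(2,3,1)] by (auto simp: b_def)
  have b': "x \<notin> L" if "Re z \<le> x" "x < b" for x
    using cInf_lower[OF _ B(3), of x] that by (auto simp: b_def)
  define a where "a = Sup (L \<inter> {..Re z})"
  have A: "closed (L \<inter> {..Re z})" "L \<inter> {..Re z} \<noteq> {}" "bdd_above (L \<inter> {..Re z})"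
    using \<open>closed L\<close> out[of "- M - 1"] zM by (auto intro!: exI[of _ "- M - 1"])
  have a: "a \<in> L" "a \<le> Re z" using closed_contains_Sup[OF A(2,3,1)] by (auto simp: a_def)
  have a': "x \<notin> L" if "x \<le> Re z" "a < x" for x
    using cSup_upper[OF _ A(3), of x] that by (auto simp: a_def)
  have "Re z \<notin> L" using assms(3) by (simp add: L_def)
  then have lt: "a < Re z" "Re z < b" using a b by (auto simp: less_le)
  have "hseg (a, b, Im z) \<subseteq> U"
  proof
    fix w assume w: "w \<in> hseg (a, b, Im z)"
    then have "Re w \<notin> L" using a'[of "Re w"] b'[of "Re w"] by auto linarith
    moreover have "Complex (Re w) (Im z) = w" using w by (simp add: complex_eq_iff)
    ultimately show "w \<in> U" by (simp add: L_def)
  qed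
  then have "chord U (a, b, Im z)" using lt a b by (auto simp: chord_def L_def)
  then show thesis using that lt by auto
qed

text \<open>
  Near its two clean ends the chord can be moved by definition; the compact middle part has a
  positive distance to the complement of the open set \<open>U\<close>.
\<close>
lemma chord_between_clean_ends_persists:
  assumes "open U" "chord U (a, b, y)" "clean_end U 1 (Complex a y)" "clean_end U (-1) (Complex b y)"
  shows "\<exists>\<delta>>0. \<forall>y'. \<bar>y' - y\<bar> < \<delta> \<longrightarrow> chord U (a, b, y')"
proof -
  from assms(3) obtain d1 where d1: "d1 > 0" "\<And>z. \<bar>Re z - a\<bar> < d1 \<Longrightarrow> \<bar>Im z - y\<bar> < d1 \<Longrightarrow>
     (Re z > a \<longrightarrow> z \<in> U) \<and> (Re z = a \<longrightarrow> z \<notin> U)" unfolding clean_end_def by auto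
  from assms(4) obtain d2 where d2: "d2 > 0" "\<And>z. \<bar>Re z - b\<bar> < d2 \<Longrightarrow> \<bar>Im z - y\<bar> < d2 \<Longrightarrow>
     (Re z < b \<longrightarrow> z \<in> U) \<and> (Re z = b \<longrightarrow> z \<notin> U)" unfolding clean_end_def by auto
  have ab: "a < b" using assms(2) by (simp add: chord_def)
  define S where "S = cbox (Complex (a + d1 / 2) y) (Complex (b - d2 / 2) y)"
  have "S \<subseteq> hseg (a, b, y)" using d1(1) d2(1) by (auto simp: S_def in_cbox_complex_iff)
  then have "S \<subseteq> U" using assms(2) by (auto simp: chord_def)
  moreover have "compact S" by (simp add: S_def)
  ultimately obtain e where e: "e > 0" "(\<Union>x\<in>S. ball x e) \<subseteq> U"
    using compact_subset_open_imp_ball_epsilon_subset[of S U] assms(1) by metis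
  define d where "d = min d1 (min d2 e)"
  have "chord U (a, b, y')" if y': "\<bar>y' - y\<bar> < d" for y'
  proof -
    have "z \<in> U" if z: "a < Re z" "Re z < b" "Im z = y'" for z
    proof -
      consider "Re z < a + d1" | "Re z > b - d2" | "a + d1 \<le> Re z" "Re z \<le> b - d2" by linarith
      then show ?thesis
      proof cases
        case 1
        then show ?thesis using d1(2)[of z] z y' by (auto simp: d_def)
      next
        case 2
        then show ?thesis using d2(2)[of z] z y' by (auto simp: d_def)
      next
        case 3
        then have "Complex (Re z) y \<in> S" using d1(1) d2(1) by (auto simp: S_def in_cbox_complex_iff)
        moreover have "z \<in> ball (Complex (Re z) y) e"
          using z y' by (auto simp: d_def dist_norm cmod_def power2_commute)
        ultimately show ?thesis using e(2) by blast
      qed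
    qed
    moreover have "Complex a y' \<notin> U" "Complex b y' \<notin> U"
      using d1(2)[of "Complex a y'"] d2(2)[of "Complex b y'"] d1(1) d2(1) y' by (auto simp: d_def)
    ultimately show ?thesis using ab by (auto simp: chord_def)
  qed
  moreover have "d > 0" using d1 d2 e by (simp add: d_def)
  ultimately show ?thesis by blast
qed

definition half_ball :: "real \<Rightarrow> complex \<Rightarrow> real \<Rightarrow> complex set" where
  "half_ball \<sigma> p e = {z \<in> ball p e. \<sigma> * (Im z - Im p) > 0}"

lemma convex_half_ball: "convex (half_ball \<sigma> p e)"
proof -
  have "half_ball \<sigma> p e = ball p e \<inter> {z. (of_real \<sigma> * \<i>) \<bullet> z > \<sigma> * Im p}"
    by (auto simp: half_ball_def inner_complex_def algebra_simps)
  then show ?thesis by (simp add: convex_Int convex_halfspace_gt)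
qed

lemma half_ball_nonempty:
  assumes "e > 0" "\<bar>\<sigma>\<bar> = 1"
  shows "half_ball \<sigma> p e \<noteq> {}"
proof -
  have "\<sigma> * \<sigma> = 1" using assms(2) by (metis abs_mult_self_eq mult_1)
  then have "p + Complex 0 (\<sigma> * e / 2) \<in> half_ball \<sigma> p e"
    using assms by (auto simp: half_ball_def dist_norm cmod_def abs_mult mult.assoc[symmetric])
  then show ?thesis by blast
qed

text \<open>
  \<open>Q\<close> contains the ends that need not be clean; for a polygon these are the reflex vertices. The last
  assumption, that a point of \<open>Q\<close> does not end one chord from the left and another one from the
  right, makes the number of cuts at most the number of points of \<open>Q\<close>.
\<close>
locale chord_domain =
  fixes U Q :: "complex set"
  assumes open_U: "open U" and bounded_U: "bounded U" and connected_U: "connected U"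
    and finite_Q: "finite Q"
    and left_end: "\<And>a b y. chord U (a, b, y) \<Longrightarrow> clean_end U 1 (Complex a y) \<or> Complex a y \<in> Q"
    and right_end: "\<And>a b y. chord U (a, b, y) \<Longrightarrow> clean_end U (-1) (Complex b y) \<or> Complex b y \<in> Q"
    and one_sided: "\<And>a b c y. chord U (a, b, y) \<Longrightarrow> chord U (b, c, y) \<Longrightarrow> Complex b y \<notin> Q"
begin

definition cuts :: "(real \<times> real \<times> real) set" where
  "cuts = {(a, b, y). chord U (a, b, y) \<and>
     \<not> (clean_end U 1 (Complex a y) \<and> clean_end U (-1) (Complex b y))}"

definition uncut :: "complex set" where "uncut = U - \<Union>(hseg ` cuts)"

lemma chord_cut: "c \<in> cuts \<Longrightarrow> chord U c"
  by (auto simp: cuts_def)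

text \<open>
  Every cut has an end in \<open>Q\<close>, and a chord is determined by one of its ends together with the side
  from which it arrives; at a point of \<open>Q\<close> only one side is possible.
\<close>
lemma finite_cuts: "finite cuts" and card_cuts: "card cuts \<le> card Q"
proof -
  define f where "f = (\<lambda>(a, b, y). if Complex a y \<in> Q then Complex a y else Complex b y)"
  have f: "f c \<in> Q" if "c \<in> cuts" for c
  proof -
    obtain a b y where c: "c = (a, b, y)" by (cases c)
    show ?thesis using that left_end[of a b y] right_end[of a b y] by (auto simp: cuts_def f_def c)
  qed
  have "inj_on f cuts"
  proof (rule inj_onI)
    fix c c' assume *: "c \<in> cuts" "c' \<in> cuts" "f c = f c'"
    obtain a b y a' b' y' where c: "c = (a, b, y)" "c' = (a', b', y')" by (cases c, cases c') auto
    have ch: "chord U (a, b, y)" "chord U (a', b', y')" using * c chord_cut by auto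
    have "f c \<in> Q" using f * by simp
    have y: "y' = y" using * c by (auto simp: f_def split: if_splits)
    consider "a = a' \<or> b = b'" | "a = b'" "Complex a y \<in> Q" | "b = a'" "Complex b y \<in> Q"
      using * c f[of c] f[of c'] by (auto simp: f_def split: if_splits)
    then show "c = c'"
    proof cases
      case 1
      then show ?thesis using chord_same_end[of U a b y a' b'] ch c y by auto
    next
      case 2
      then show ?thesis using one_sided[of a' a y b] ch y by auto
    next
      case 3
      then show ?thesis using one_sided[of a b y b'] ch y by auto
    qed
  qed
  moreover have "f ` cuts \<subseteq> Q" using f by blast
  ultimately show "finite cuts" "card cuts \<le> card Q"
    using finite_Q card_inj_on_le inj_on_finite by blast+
qed

text \<open>
  The segments of the cuts are not closed, but their missing ends are outside \<open>U\<close>, so that inside \<open>U\<close>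
  they agree with closed segments.
\<close>
lemma open_minus_cuts:
  assumes "K \<subseteq> cuts"
  shows "open (U - \<Union>(hseg ` K))"
proof -
  define cl where "cl = (\<lambda>(a, b, y). cbox (Complex a y) (Complex b y))"
  have eq: "U \<inter> cl c = U \<inter> hseg c" if "c \<in> K" for c
  proof -
    obtain a b y where c: "c = (a, b, y)" by (cases c)
    have "Complex a y \<notin> U" "Complex b y \<notin> U" using that assms chord_cut[of c] by (auto simp: chord_def c)
    then have "Re z \<noteq> a \<and> Re z \<noteq> b" if "z \<in> U" "Im z = y" for z
      using that by (metis complex_surj)
    then show ?thesis by (fastforce simp: cl_def c in_cbox_complex_iff)
  qed
  have "U - \<Union>(hseg ` K) = U - \<Union>(cl ` K)" using eq by blast
  moreover have "finite K" using assms finite_cuts finite_subset by blast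
  then have "closed (\<Union>(cl ` K))" by (intro closed_UN) (auto simp: cl_def)
  ultimately show ?thesis using open_U by (simp add: open_Diff)
qed

lemma open_uncut: "open uncut"
  unfolding uncut_def by (rule open_minus_cuts) simp

lemma hseg_disjoint:
  assumes "chord U c" "chord U c'" "c \<noteq> c'"
  shows "hseg c \<inter> hseg c' = {}"
  using chord_unique[OF assms(1,2)] assms(3) by blast

lemma chord_through_uncut:
  assumes "z \<in> uncut"
  obtains a b where "chord U (a, b, Im z)" "z \<in> hseg (a, b, Im z)" "hseg (a, b, Im z) \<subseteq> uncut"
    "clean_end U 1 (Complex a (Im z))" "clean_end U (-1) (Complex b (Im z))"
proof -
  obtain a b where ab: "chord U (a, b, Im z)" "z \<in> hseg (a, b, Im z)"
    using chord_exists[OF open_U bounded_U, of z] assms by (auto simp: uncut_def)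
  then have "(a, b, Im z) \<notin> cuts" using assms by (auto simp: uncut_def)
  then have "clean_end U 1 (Complex a (Im z))" "clean_end U (-1) (Complex b (Im z))"
    using ab by (auto simp: cuts_def)
  moreover have "hseg (a, b, Im z) \<inter> hseg c = {}" if "c \<in> cuts" for c
    using hseg_disjoint[OF ab(1) chord_cut[OF that]] that \<open>(a, b, Im z) \<notin> cuts\<close> by blast
  then have "hseg (a, b, Im z) \<subseteq> uncut" using ab(1) by (auto simp: uncut_def chord_def)
  ultimately show thesis using that ab by blast
qed

text \<open>
  The abscissae of the chord through a point are locally constant, hence constant on the component
  \<open>D\<close>. As \<open>D\<close> contains with each point the whole chord through it, it is the product of a fixed
  interval with its projection to the vertical axis, which is an open bounded interval.
\<close>
lemma component_is_box:
  assumes "D \<in> components uncut"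
  shows "\<exists>p q. D = box p q"
proof -
  have D: "D \<noteq> {}" "connected D" "D \<subseteq> uncut" "open D"
    using assms in_components_nonempty in_components_connected in_components_subset
      open_components open_uncut by blast+
  define ends where "ends z = (THE (a, b). chord U (a, b, Im z) \<and> z \<in> hseg (a, b, Im z))" for z
  have ends: "ends z = (a, b)" if "chord U (a, b, Im z)" "z \<in> hseg (a, b, Im z)" for z a b
    unfolding ends_def
  proof (rule the_equality)
    show "case (a, b) of (a, b) \<Rightarrow> chord U (a, b, Im z) \<and> z \<in> hseg (a, b, Im z)" using that by simp
    fix t assume t: "case t of (a, b) \<Rightarrow> chord U (a, b, Im z) \<and> z \<in> hseg (a, b, Im z)"
    obtain a' b' where t_eq: "t = (a', b')" by (cases t)
    have "chord U (a', b', Im z)" "z \<in> hseg (a', b', Im z)" using t by (simp_all add: t_eq)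
    from chord_unique[OF this(1) that(1) this(2) that(2)] show "t = (a, b)" by (simp add: t_eq)
  qed
  have loc: "\<forall>z\<in>D. eventually (\<lambda>w. ends z = ends w) (at z within D)"
  proof
    fix z assume "z \<in> D"
    then have "z \<in> uncut" using D(3) by blast
    then obtain a b where ab: "chord U (a, b, Im z)" "z \<in> hseg (a, b, Im z)"
      "hseg (a, b, Im z) \<subseteq> uncut" "clean_end U 1 (Complex a (Im z))" "clean_end U (-1) (Complex b (Im z))"
      by (rule chord_through_uncut)
    obtain d where d: "d > 0" "\<And>y'. \<bar>y' - Im z\<bar> < d \<Longrightarrow> chord U (a, b, y')"
      using chord_between_clean_ends_persists[OF open_U ab(1,4,5)] by blast
    define N where "N = ball z d \<inter> {w. a < Re w} \<inter> {w. Re w < b}"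
    have "open N" "z \<in> N" using ab(2) d(1)
      by (auto simp: N_def intro!: open_Int open_halfspace_Re_gt open_halfspace_Re_lt)
    moreover have "ends z = ends w" if "w \<in> N" for w
    proof -
      have "\<bar>Im w - Im z\<bar> < d"
        using that abs_Im_le_cmod[of "w - z"] by (auto simp: N_def dist_norm norm_minus_commute)
      then show ?thesis using ends[OF ab(1,2)] ends[of a b w] d(2) that by (auto simp: N_def)
    qed
    ultimately show "eventually (\<lambda>w. ends z = ends w) (at z within D)"
      unfolding eventually_at_topological by blast
  qed
  obtain z0 where z0: "z0 \<in> D" using D by blast
  obtain a b where ab0: "ends z0 = (a, b)" by (cases "ends z0")
  have row: "z \<in> hseg (a, b, Im z) \<and> hseg (a, b, Im z) \<subseteq> D" if z: "z \<in> D" for z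
  proof -
    have "z \<in> uncut" using D(3) z by blast
    then obtain a' b' where ab: "chord U (a', b', Im z)" "z \<in> hseg (a', b', Im z)"
      "hseg (a', b', Im z) \<subseteq> uncut" "clean_end U 1 (Complex a' (Im z))" "clean_end U (-1) (Complex b' (Im z))"
      by (rule chord_through_uncut)
    have "ends z = ends z0" using connected_local_const[OF D(2) z z0 loc] .
    then have "a' = a" "b' = b" using ends[OF ab(1,2)] ab0 by auto
    moreover have "hseg (a', b', Im z) \<subseteq> D"
      using components_maximal[OF assms convex_connected[OF convex_hseg] ab(3)] ab(2) z by blast
    ultimately show ?thesis using ab by blast
  qed
  define I where "I = Im ` D"
  have "bounded D" using D bounded_U by (auto simp: uncut_def intro: bounded_subset)
  then have "bounded I" unfolding I_def by (intro bounded_linear_image bounded_linear_Im)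
  have "connected I" unfolding I_def by (intro connected_continuous_image D continuous_intros)
  have "open I"
  proof (rule openI)
    fix y assume "y \<in> I"
    then obtain z where z: "z \<in> D" "y = Im z" by (auto simp: I_def)
    then obtain e where e: "e > 0" "ball z e \<subseteq> D" using D(4) openE by blast
    have "y' \<in> I" if "y' \<in> ball y e" for y'
    proof -
      have "Complex (Re z) y' \<in> ball z e" using that z by (simp add: dist_norm cmod_def)
      then have "Complex (Re z) y' \<in> D" using e(2) by blast
      then show ?thesis unfolding I_def by force
    qed
    then show "\<exists>e>0. ball y e \<subseteq> I" using e(1) by blast
  qed
  have "I \<noteq> {}" using D by (simp add: I_def)
  have I: "I = {Inf I<..<Sup I}"
  proof
    show "I \<subseteq> {Inf I<..<Sup I}"
    proof
      fix y assume y: "y \<in> I"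
      with \<open>open I\<close> obtain e where e: "e > 0" "cball y e \<subseteq> I" using open_contains_cball by blast
      then have "y - e \<in> I" "y + e \<in> I" by (auto simp: subset_iff dist_real_def)
      then have "Inf I \<le> y - e" "y + e \<le> Sup I"
        using \<open>bounded I\<close> by (auto intro!: cInf_lower cSup_upper bounded_imp_bdd_below bounded_imp_bdd_above)
      then show "y \<in> {Inf I<..<Sup I}" using e by auto
    qed
    show "{Inf I<..<Sup I} \<subseteq> I"
    proof
      fix y assume y: "y \<in> {Inf I<..<Sup I}"
      then obtain s t where "s \<in> I" "s < y" "t \<in> I" "y < t"
        using \<open>I \<noteq> {}\<close> \<open>bounded I\<close> by (metis cInf_lessD greaterThanLessThan_iff less_cSupD)
      then show "y \<in> I" using \<open>connected I\<close> connectedD_interval[of I s t y] by auto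
    qed
  qed
  have "D = box (Complex a (Inf I)) (Complex b (Sup I))"
  proof (intro set_eqI iffI)
    fix z assume z: "z \<in> D"
    then have "Im z \<in> I" by (simp add: I_def)
    then show "z \<in> box (Complex a (Inf I)) (Complex b (Sup I))"
      using row[OF z] I by (auto simp: in_box_complex_iff)
  next
    fix z assume z: "z \<in> box (Complex a (Inf I)) (Complex b (Sup I))"
    then have "Im z \<in> I" using I by (auto simp: in_box_complex_iff)
    then obtain w where w: "w \<in> D" "Im w = Im z" by (auto simp: I_def)
    then show "z \<in> D" using row[OF w(1)] z by (auto simp: in_box_complex_iff subset_iff)
  qed
  then show ?thesis by blast
qed

lemma ball_at_cut:
  assumes "c \<in> cuts" "p \<in> hseg c"
  shows "\<exists>e>0. \<forall>z\<in>ball p e. if Im z = Im p then z \<in> hseg c else z \<in> uncut"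
proof -
  obtain a b y where c: "c = (a, b, y)" by (cases c)
  define N where "N = (U - \<Union>(hseg ` (cuts - {c}))) \<inter> {w. a < Re w} \<inter> {w. Re w < b}"
  have "open N" unfolding N_def
    by (intro open_Int open_minus_cuts open_halfspace_Re_gt open_halfspace_Re_lt) auto
  moreover have "p \<in> N"
  proof -
    have "p \<in> U" using chord_cut[OF assms(1)] assms(2) by (auto simp: chord_def c)
    moreover have "p \<notin> hseg c'" if "c' \<in> cuts - {c}" for c'
      using hseg_disjoint[of c c'] chord_cut assms that by blast
    ultimately show ?thesis using assms(2) by (auto simp: N_def c)
  qed
  ultimately obtain e where e: "e > 0" "ball p e \<subseteq> N" using openE by blast
  have "if Im z = Im p then z \<in> hseg c else z \<in> uncut" if "z \<in> ball p e" for z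
  proof -
    have "z \<in> N" using e that by blast
    then show ?thesis using assms(2) by (auto simp: N_def uncut_def c)
  qed
  then show ?thesis using e by blast
qed

text \<open>
  The component containing the small upper (or lower) half balls around a point of the cut is a
  locally constant function of that point, and the cut is connected.
\<close>
lemma component_beside_cut:
  assumes c: "c \<in> cuts" and \<sigma>: "\<bar>\<sigma>\<bar> = 1"
  shows "\<exists>D\<in>components uncut. \<forall>p\<in>hseg c. \<exists>e>0. half_ball \<sigma> p e \<subseteq> D"
proof -
  define P where "P p D \<longleftrightarrow> D \<in> components uncut \<and> (\<exists>e>0. half_ball \<sigma> p e \<subseteq> D)" for p D
  have ex: "\<exists>D. P p D" if p: "p \<in> hseg c" for p
  proof -
    obtain e where e: "e > 0" "\<forall>z\<in>ball p e. if Im z = Im p then z \<in> hseg c else z \<in> uncut"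
      using ball_at_cut[OF c p] by blast
    have "half_ball \<sigma> p e \<subseteq> uncut"
    proof
      fix z assume "z \<in> half_ball \<sigma> p e"
      then have "z \<in> ball p e" "Im z \<noteq> Im p" by (auto simp: half_ball_def)
      then show "z \<in> uncut" using e(2) by (metis (full_types))
    qed
    then obtain D where "D \<in> components uncut" "half_ball \<sigma> p e \<subseteq> D"
      using exists_component_superset half_ball_nonempty[OF e(1) \<sigma>]
        convex_connected[OF convex_half_ball] by (metis subset_empty)
    then show ?thesis using e by (auto simp: P_def)
  qed
  have uniq: "D = D'" if "P p D" "P p D'" for p D D'
  proof -
    obtain e e' where e: "e > 0" "half_ball \<sigma> p e \<subseteq> D" "e' > 0" "half_ball \<sigma> p e' \<subseteq> D'"
      using \<open>P p D\<close> \<open>P p D'\<close> by (auto simp: P_def)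
    have "half_ball \<sigma> p (min e e') \<noteq> {}" using half_ball_nonempty \<sigma> e by simp
    moreover have "half_ball \<sigma> p (min e e') \<subseteq> half_ball \<sigma> p e \<inter> half_ball \<sigma> p e'"
      by (auto simp: half_ball_def)
    ultimately have "D \<inter> D' \<noteq> {}" using e by blast
    then show ?thesis using that components_nonoverlap by (auto simp: P_def)
  qed
  define f where "f p = (THE D. P p D)" for p
  have f: "f p = D" if "P p D" for p D
    unfolding f_def using that uniq[OF _ that] by (rule the_equality)
  have "\<forall>p\<in>hseg c. eventually (\<lambda>p'. f p = f p') (at p within hseg c)"
  proof
    fix p assume p: "p \<in> hseg c"
    obtain D where D: "P p D" using ex[OF p] by blast
    then obtain e where e: "e > 0" "half_ball \<sigma> p e \<subseteq> D" by (auto simp: P_def)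
    have "f p = f p'" if p': "p' \<in> hseg c" "p' \<in> ball p e" for p'
    proof -
      have "Im p' = Im p" using p p' by (cases c) auto
      then have "half_ball \<sigma> p' (e - dist p p') \<subseteq> half_ball \<sigma> p e"
        using dist_triangle[of p _ p'] by (auto simp: half_ball_def) (smt (verit))
      moreover have "e - dist p p' > 0" using p' by simp
      ultimately have "P p' D" using D e unfolding P_def by blast
      then show ?thesis using f D by simp
    qed
    then show "eventually (\<lambda>p'. f p = f p') (at p within hseg c)"
      unfolding eventually_at_topological using e by (intro exI[of _ "ball p e"]) auto
  qed
  then have const: "f p = f p'" if "p \<in> hseg c" "p' \<in> hseg c" for p p'
    using connected_local_const[OF convex_connected[OF convex_hseg]] that by blast
  obtain a b y where c_eq: "c = (a, b, y)" by (cases c)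
  then have "a < b" using chord_cut[OF c] by (simp add: chord_def)
  then have "Complex ((a + b) / 2) y \<in> hseg c" by (simp add: c_eq)
  then obtain p0 where p0: "p0 \<in> hseg c" by blast
  have "P p (f p0)" if "p \<in> hseg c" for p
    using ex[OF that] f const[OF p0 that] by metis
  then show ?thesis using p0 by (auto simp: P_def)
qed

text \<open>
  A set \<open>S\<close> of components that is closed under crossing cuts, together with the cuts it touches, is
  open (this is \<open>A S\<close>), and so is the corresponding set for the other components. These two sets
  partition the connected set \<open>U\<close>, so one of them is empty. This is the hypothesis of
  \<open>spanning_count\<close>.
\<close>
theorem box_decomposition:
  "\<exists>\<D>. finite \<D> \<and> card \<D> \<le> card Q + 1 \<and> (\<forall>D\<in>\<D>. D \<subseteq> U \<and> D \<noteq> {} \<and> (\<exists>p q. D = box p q)) \<and>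
     disjoint \<D> \<and> negligible (U - \<Union>\<D>)"
proof -
  have "\<forall>c\<in>cuts. \<exists>D\<in>components uncut. \<forall>p\<in>hseg c. \<exists>e>0. half_ball 1 p e \<subseteq> D"
    using component_beside_cut by simp
  then obtain up where up: "\<And>c. c \<in> cuts \<Longrightarrow> up c \<in> components uncut"
    "\<And>c p. c \<in> cuts \<Longrightarrow> p \<in> hseg c \<Longrightarrow> \<exists>e>0. half_ball 1 p e \<subseteq> up c" by metis
  have "\<forall>c\<in>cuts. \<exists>D\<in>components uncut. \<forall>p\<in>hseg c. \<exists>e>0. half_ball (-1) p e \<subseteq> D"
    using component_beside_cut by simp
  then obtain dn where dn: "\<And>c. c \<in> cuts \<Longrightarrow> dn c \<in> components uncut"
    "\<And>c p. c \<in> cuts \<Longrightarrow> p \<in> hseg c \<Longrightarrow> \<exists>e>0. half_ball (-1) p e \<subseteq> dn c" by metis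
  define A where "A S = \<Union>S \<union> \<Union>(hseg ` {c \<in> cuts. up c \<in> S})" for S
  have open_A: "open (A S)"
    if S: "S \<subseteq> components uncut" "\<And>c. c \<in> cuts \<Longrightarrow> up c \<in> S \<longleftrightarrow> dn c \<in> S" for S
  proof (rule openI)
    fix z assume "z \<in> A S"
    then consider D where "D \<in> S" "z \<in> D" | c where "c \<in> cuts" "up c \<in> S" "z \<in> hseg c"
      unfolding A_def by blast
    then show "\<exists>e>0. ball z e \<subseteq> A S"
    proof cases
      case 1
      then have "open D" using open_components[OF open_uncut] S by blast
      then obtain e where "e > 0" "ball z e \<subseteq> D" using 1 openE by blast
      then show ?thesis using 1 unfolding A_def by blast
    next
      case 2
      obtain e1 where e1: "e1 > 0" "\<forall>w\<in>ball z e1. if Im w = Im z then w \<in> hseg c else w \<in> uncut"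
        using ball_at_cut 2 by blast
      obtain e2 where e2: "e2 > 0" "half_ball 1 z e2 \<subseteq> up c" using up(2) 2 by blast
      obtain e3 where e3: "e3 > 0" "half_ball (-1) z e3 \<subseteq> dn c" using dn(2) 2 by blast
      have "w \<in> A S" if w: "w \<in> ball z (min e1 (min e2 e3))" for w
      proof -
        consider "Im w = Im z" | "Im w > Im z" | "Im w < Im z" by linarith
        then show ?thesis
        proof cases
          case 1
          then have "w \<in> hseg c" using e1 w by simp
          then show ?thesis using \<open>c \<in> cuts\<close> \<open>up c \<in> S\<close> unfolding A_def by blast
        next
          case 2
          then have "w \<in> half_ball 1 z e2" using w by (simp add: half_ball_def)
          then show ?thesis using e2 \<open>up c \<in> S\<close> unfolding A_def by blast
        next
          case 3
          then have "w \<in> half_ball (-1) z e3" using w by (simp add: half_ball_def)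
          then show ?thesis using e3 \<open>up c \<in> S\<close> S(2)[OF \<open>c \<in> cuts\<close>] unfolding A_def by blast
        qed
      qed
      then show ?thesis using e1 e2 e3 by (intro exI[of _ "min e1 (min e2 e3)"]) auto
    qed
  qed
  have component_avoids_cut: "z \<notin> hseg c" if "z \<in> D" "D \<in> components uncut" "c \<in> cuts" for z D c
    using that in_components_subset[OF that(2)] by (auto simp: uncut_def)
  have conn: "S = {} \<or> S = components uncut"
    if S: "S \<subseteq> components uncut" "\<And>c. c \<in> cuts \<Longrightarrow> up c \<in> S \<longleftrightarrow> dn c \<in> S" for S
  proof -
    let ?S' = "components uncut - S"
    have o: "open (A S)" "open (A ?S')" using open_A[OF S] open_A[of ?S'] S up dn by auto
    have "U \<subseteq> A S \<union> A ?S'"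
    proof
      fix z assume z: "z \<in> U"
      show "z \<in> A S \<union> A ?S'"
      proof (cases "z \<in> uncut")
        case True
        then obtain D where "D \<in> components uncut" "z \<in> D" using Union_components by blast
        then show ?thesis by (auto simp: A_def)
      next
        case False
        then obtain c where "c \<in> cuts" "z \<in> hseg c" using z by (auto simp: uncut_def)
        then show ?thesis using up(1) unfolding A_def by blast
      qed
    qed
    moreover have "A S \<inter> A ?S' = {}"
    proof (rule ccontr)
      assume "A S \<inter> A ?S' \<noteq> {}"
      then obtain z where z: "z \<in> A S" "z \<in> A ?S'" by blast
      from z(1) consider D where "D \<in> S" "z \<in> D" | c where "c \<in> cuts" "up c \<in> S" "z \<in> hseg c"
        unfolding A_def by blast
      then show False
      proof cases
        case 1
        then have "z \<notin> hseg c" if "c \<in> cuts" for c using component_avoids_cut that S by blast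
        then obtain D' where "D' \<in> ?S'" "z \<in> D'" using z(2) unfolding A_def by blast
        then show False using 1 S components_nonoverlap[of D uncut D'] by blast
      next
        case 2
        have "z \<notin> D" if "D \<in> ?S'" for D using component_avoids_cut that 2 by blast
        then obtain c' where "c' \<in> cuts" "up c' \<notin> S" "z \<in> hseg c'" using z(2) unfolding A_def by blast
        then show False using 2 chord_unique[OF chord_cut chord_cut, of c c' z] by blast
      qed
    qed
    moreover have "A S \<subseteq> U" "A ?S' \<subseteq> U"
      using S in_components_subset[of _ uncut] chord_cut by (fastforce simp: A_def uncut_def chord_def)+
    ultimately have "A S = {} \<or> A ?S' = {}"
      using connectedD[OF connected_U o] by blast
    then show ?thesis
    proof
      assume "A S = {}"
      then have "D = {}" if "D \<in> S" for D using that unfolding A_def by blast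
      then have "S = {}" using S(1) in_components_nonempty by blast
      then show ?thesis ..
    next
      assume "A ?S' = {}"
      then have "D = {}" if "D \<in> ?S'" for D using that unfolding A_def by blast
      then have "?S' = {}" using in_components_nonempty by blast
      then show ?thesis using S by blast
    qed
  qed
  have "finite (components uncut) \<and> card (components uncut) \<le> card cuts + 1"
    using spanning_count[of cuts up "components uncut" dn] finite_cuts up(1) dn(1) conn by blast
  moreover have "U - \<Union>(components uncut) \<subseteq> \<Union>(hseg ` cuts)"
    unfolding Union_components[symmetric] by (auto simp: uncut_def)
  moreover have "negligible (\<Union>(hseg ` cuts))"
    using finite_cuts negligible_hseg by (intro negligible_Union) auto
  moreover have "disjoint (components uncut)"
    using components_nonoverlap by (fastforce simp: disjoint_def)
  moreover have "D \<subseteq> U" if "D \<in> components uncut" for D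
    using in_components_subset[OF that] by (auto simp: uncut_def)
  moreover have "D \<noteq> {} \<and> (\<exists>p q. D = box p q)" if "D \<in> components uncut" for D
    using in_components_nonempty[OF that] component_is_box[OF that] by blast
  ultimately show ?thesis
    using card_cuts negligible_subset[of "\<Union>(hseg ` cuts)" "U - \<Union>(components uncut)"]
    by (intro exI[of _ "components uncut"]) auto
qed

end

section \<open>Local structure of a simple polygon\<close>

definition edge_vector :: "complex list \<Rightarrow> nat \<Rightarrow> complex" where
  "edge_vector ps k = next_vertex ps k - ps ! k"

lemma mem_polygon_edge:
  "z \<in> polygon_edge ps k \<longleftrightarrow> (\<exists>s. 0 \<le> s \<and> s \<le> 1 \<and> z = ps ! k + of_real s * edge_vector ps k)"
  unfolding polygon_edge_def edge_vector_def in_segment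
  by (simp add: scaleR_conv_of_real algebra_simps)

locale simple_closed_polygon =
  fixes ps :: "complex list"
  assumes simple: "simple_polygon ps"
begin

abbreviation "m \<equiv> length ps"
abbreviation "E \<equiv> polygon_edge ps"
abbreviation "B \<equiv> polygon_boundary ps"
abbreviation "I \<equiv> inside (polygon_boundary ps)"

lemma length_ge_3: "m \<ge> 3" and distinct_vertices: "distinct ps"
  and adjacent_edges: "k < m \<Longrightarrow> E k \<inter> E ((k + 1) mod m) = {next_vertex ps k}"
  and disjoint_edges: "j < m \<Longrightarrow> k < m \<Longrightarrow> j \<noteq> k \<Longrightarrow> k \<noteq> (j + 1) mod m \<Longrightarrow>
    j \<noteq> (k + 1) mod m \<Longrightarrow> E j \<inter> E k = {}"
  using simple unfolding simple_polygon_def by blast+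

lemma next_less: "(k + 1) mod m < m"
  using length_ge_3 by (intro mod_less_divisor) linarith

lemma next_neq: "k < m \<Longrightarrow> (k + 1) mod m \<noteq> k"
  using length_ge_3 by (cases "k + 1 = m") auto

lemma edge_vector_nonzero:
  assumes "k < m"
  shows "edge_vector ps k \<noteq> 0"
  using distinct_vertices next_neq[OF assms] next_less[of k] assms
  unfolding edge_vector_def next_vertex_def by (simp add: nth_eq_iff_index_eq)

lemma polygonal_arc:
  assumes "0 < j" "j < m"
  shows "\<exists>g. arc g \<and> pathstart g = ps ! 0 \<and> pathfinish g = ps ! j \<and> path_image g = (\<Union>k<j. E k)"
  using assms
proof (induction j)
  case 0
  then show ?case by simp
next
  case (Suc j)
  have next_j: "next_vertex ps j = ps ! Suc j" using Suc.prems by (simp add: next_vertex_def)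
  let ?l = "linepath (ps ! j) (ps ! Suc j)"
  have l: "arc ?l" "path_image ?l = E j"
    using Suc.prems distinct_vertices
    by (auto simp: polygon_edge_def next_j nth_eq_iff_index_eq intro!: arc_linepath)
  show ?case
  proof (cases "j = 0")
    case True
    then show ?thesis using l by (intro exI[of _ ?l]) (auto simp: lessThan_Suc)
  next
    case False
    with Suc obtain g where g: "arc g" "pathstart g = ps ! 0" "pathfinish g = ps ! j"
      "path_image g = (\<Union>k<j. E k)" by auto
    have "E k \<inter> E j \<subseteq> {ps ! j}" if "k < j" for k
    proof (cases "Suc k = j")
      case True
      then show ?thesis using adjacent_edges[of k] Suc.prems by (auto simp: next_vertex_def)
    next
      case False
      then show ?thesis using disjoint_edges[of k j] that Suc.prems by auto
    qed
    then have "path_image g \<inter> path_image ?l \<subseteq> {pathstart ?l}" unfolding g(4) l(2) by auto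
    then have "arc (g +++ ?l)" using g l by (intro arc_join) auto
    moreover have "path_image (g +++ ?l) = (\<Union>k<Suc j. E k)"
      using g l by (subst path_image_join) (auto simp: lessThan_Suc)
    ultimately show ?thesis using g by (intro exI[of _ "g +++ ?l"]) auto
  qed
qed

text \<open>
  The boundary is traversed by a simple closed path, which gives access to the Jordan curve theorem.
\<close>
lemma polygonal_loop:
  "\<exists>c. simple_path c \<and> pathfinish c = pathstart c \<and> path_image c = B"
proof -
  define j where "j = m - 1"
  have j: "0 < j" "j < m" "Suc j = m" using length_ge_3 by (auto simp: j_def)
  obtain g where g: "arc g" "pathstart g = ps ! 0" "pathfinish g = ps ! j"
      "path_image g = (\<Union>k<j. E k)" using polygonal_arc[OF j(1,2)] by blast
  have next_j: "next_vertex ps j = ps ! 0" using j by (simp add: next_vertex_def)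
  let ?l = "linepath (ps ! j) (ps ! 0)"
  have "ps ! j \<noteq> ps ! 0" using j length_ge_3 nth_eq_iff_index_eq[OF distinct_vertices, of j 0] by linarith
  then have l: "arc ?l" "path_image ?l = E j" by (auto simp: polygon_edge_def next_j)
  have "E k \<inter> E j \<subseteq> {ps ! 0, ps ! j}" if "k < j" for k
  proof -
    consider "Suc k = j" | "k = 0" | "Suc k \<noteq> j" "k \<noteq> 0" by blast
    then show ?thesis
    proof cases
      case 1
      then show ?thesis using adjacent_edges[of k] j by (auto simp: next_vertex_def)
    next
      case 2
      then show ?thesis using adjacent_edges[of j] j by (auto simp: next_vertex_def)
    next
      case 3
      then show ?thesis using disjoint_edges[of k j] that j by auto
    qed
  qed
  then have "path_image g \<inter> path_image ?l \<subseteq> {pathstart g, pathstart ?l}"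
    unfolding g(4) l(2) using g(2) by auto
  then have "simple_path (g +++ ?l)" using g l by (intro simple_path_join_loop) auto
  moreover have "path_image (g +++ ?l) = (\<Union>k<Suc j. E k)"
    using g l by (subst path_image_join) (auto simp: lessThan_Suc)
  ultimately show ?thesis using g j(3)
    by (intro exI[of _ "g +++ ?l"]) (auto simp: polygon_boundary_def)
qed

lemma jordan:
  shows inside_nonempty: "I \<noteq> {}" and open_inside_poly: "open I" and connected_inside_poly: "connected I"
    and bounded_inside_poly: "bounded I"
    and frontier_inside: "frontier I = B" and frontier_outside: "frontier (outside B) = B"
proof -
  obtain c where "simple_path c" "pathfinish c = pathstart c" "path_image c = B"
    using polygonal_loop by blast
  with Jordan_inside_outside[of c] show "I \<noteq> {}" "open I" "connected I" "bounded I"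
    "frontier I = B" "frontier (outside B) = B" by auto
qed

lemma closure_inside: "closure I = polygon_region ps"
  unfolding closure_Un_frontier frontier_inside polygon_region_def by auto

text \<open>
  A connected set cannot leave the interior without crossing its frontier, the boundary.
\<close>
lemma connected_subset_inside:
  assumes "connected S" "S \<inter> B = {}" "S \<inter> I \<noteq> {}"
  shows "S \<subseteq> I"
  using connected_Int_frontier[OF assms(1,3)] assms(2) frontier_inside by blast

lemma boundary_near_point:
  "\<exists>\<delta>>0. \<forall>z\<in>ball q \<delta>. z \<in> B \<longrightarrow> (\<exists>k<m. q \<in> E k \<and> z \<in> E k)"
proof -
  have "closed (\<Union>k\<in>{k. k < m \<and> q \<notin> E k}. E k)"
    by (intro closed_UN) (auto simp: polygon_edge_def)
  then have "open (- (\<Union>k\<in>{k. k < m \<and> q \<notin> E k}. E k))" by (rule open_Compl)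
  moreover have "q \<in> - (\<Union>k\<in>{k. k < m \<and> q \<notin> E k}. E k)" by auto
  ultimately obtain e where "e > 0" "ball q e \<subseteq> - (\<Union>k\<in>{k. k < m \<and> q \<notin> E k}. E k)"
    using openE by metis
  then show ?thesis by (intro exI[of _ e]) (fastforce simp: polygon_boundary_def)
qed

lemma edge_at_vertex:
  assumes "k < m" "j < m" "ps ! k \<in> E j"
  shows "j = k \<or> (j + 1) mod m = k"
proof (rule ccontr)
  assume *: "\<not> ?thesis"
  have k: "ps ! k \<in> E k" by (simp add: polygon_edge_def)
  then have "j = (k + 1) mod m" using disjoint_edges[of j k] assms * by auto
  then have "ps ! k = next_vertex ps k" using adjacent_edges[OF assms(1)] k assms(3) by blast
  then show False using edge_vector_nonzero[OF assms(1)] by (simp add: edge_vector_def)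
qed

lemma edge_at_nonvertex:
  assumes "k < m" "j < m" "q \<in> E k" "q \<in> E j" "q \<notin> set ps"
  shows "j = k"
proof (rule ccontr)
  assume "j \<noteq> k"
  then have "k = (j + 1) mod m \<or> j = (k + 1) mod m" using disjoint_edges assms by blast
  then have "q = next_vertex ps j \<or> q = next_vertex ps k" using adjacent_edges assms by blast
  then show False using assms(5) next_less by (auto simp: next_vertex_def)
qed

text \<open>
  Only one side passes near a boundary point that is not a vertex, and close to that point it looks
  like a full line.
\<close>
lemma boundary_near_nonvertex:
  assumes k: "k < m" and q: "q \<in> E k" "q \<notin> set ps"
  shows "\<exists>\<delta>>0. \<forall>z\<in>ball q \<delta>. z \<in> B \<longleftrightarrow> Im ((z - q) / edge_vector ps k) = 0"
proof -
  define e where "e = edge_vector ps k"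
  have e: "e \<noteq> 0" using edge_vector_nonzero[OF k] by (simp add: e_def)
  obtain s where s: "0 \<le> s" "s \<le> 1" "q = ps ! k + of_real s * e"
    using q by (auto simp: mem_polygon_edge e_def)
  have "ps ! k \<in> set ps" "next_vertex ps k \<in> set ps" using k next_less by (auto simp: next_vertex_def)
  then have "s \<noteq> 0" "s \<noteq> 1" using q(2) s by (auto simp: e_def edge_vector_def)
  then have s': "0 < s" "s < 1" using s by auto
  obtain d where d: "d > 0" "\<And>z. z \<in> ball q d \<Longrightarrow> z \<in> B \<Longrightarrow> \<exists>j<m. q \<in> E j \<and> z \<in> E j"
    using boundary_near_point by blast
  define \<delta> where "\<delta> = min d (norm e * min s (1 - s))"
  have "z \<in> B \<longleftrightarrow> Im ((z - q) / e) = 0" if z: "z \<in> ball q \<delta>" for z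
  proof
    assume "z \<in> B"
    then have "z \<in> E k" using d(2)[of z] z edge_at_nonvertex[OF k _ q(1) _ q(2)] by (auto simp: \<delta>_def)
    then obtain t where "z = ps ! k + of_real t * e" by (auto simp: mem_polygon_edge e_def)
    then have "(z - q) / e = of_real (t - s)" using e s by (simp add: field_simps)
    then show "Im ((z - q) / e) = 0" by simp
  next
    assume im: "Im ((z - q) / e) = 0"
    define x where "x = Re ((z - q) / e)"
    have x: "(z - q) / e = of_real x" using im by (simp add: x_def complex_eq_iff)
    have "norm (z - q) < norm e * min s (1 - s)"
      using z unfolding \<delta>_def by (simp add: dist_norm norm_minus_commute)
    then have "norm ((z - q) / e) < min s (1 - s)"
      using e by (subst norm_divide, subst pos_divide_less_eq) (simp_all only: mult.commute zero_less_norm_iff not_False_eq_True)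
    then have "\<bar>x\<bar> < min s (1 - s)" unfolding x by simp
    moreover have "z = ps ! k + of_real (s + x) * e" using x e s by (simp add: field_simps)
    ultimately have "z \<in> E k" unfolding mem_polygon_edge e_def[symmetric]
      by (intro exI[of _ "s + x"]) auto
    then show "z \<in> B" using k by (auto simp: polygon_boundary_def)
  qed
  moreover have "\<delta> > 0" using d s' e by (simp add: \<delta>_def)
  ultimately show ?thesis unfolding e_def by blast
qed

lemma prev_index:
  assumes "k < m" "j < m" "(j + 1) mod m = k"
  shows "prev_vertex ps k = ps ! j" "next_vertex ps j = ps ! k"
proof -
  have "(k + m - 1) mod m = j"
    using assms length_ge_3 by (cases "j + 1 = m") auto
  then show "prev_vertex ps k = ps ! j" by (simp add: prev_vertex_def)
  show "next_vertex ps j = ps ! k" using assms by (simp add: next_vertex_def)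
qed

lemma prev_index_ex:
  assumes "k < m"
  obtains j where "j < m" "(j + 1) mod m = k"
proof (cases k)
  case 0
  have "m - 1 < m" "m - 1 + 1 = m" using length_ge_3 by linarith+
  then show thesis using that[of "m - 1"] 0 by simp
next
  case (Suc j)
  then show thesis using that[of j] assms by simp
qed

definition arm_next :: "nat \<Rightarrow> complex" where "arm_next k = next_vertex ps k - ps ! k"
definition arm_prev :: "nat \<Rightarrow> complex" where "arm_prev k = prev_vertex ps k - ps ! k"

lemma boundary_near_vertex:
  assumes k: "k < m"
  shows "\<exists>\<delta>>0. \<forall>z\<in>ball (ps ! k) \<delta>. z \<in> B \<longrightarrow>
    (\<exists>s\<ge>0. z = ps ! k + of_real s * arm_next k \<or> z = ps ! k + of_real s * arm_prev k)"
proof -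
  obtain \<delta> where \<delta>: "\<delta> > 0" "\<forall>z\<in>ball (ps ! k) \<delta>. z \<in> B \<longrightarrow> (\<exists>j<m. ps ! k \<in> E j \<and> z \<in> E j)"
    using boundary_near_point by blast
  have "\<exists>s\<ge>0. z = ps ! k + of_real s * arm_next k \<or> z = ps ! k + of_real s * arm_prev k"
    if z: "z \<in> ball (ps ! k) \<delta>" "z \<in> B" for z
  proof -
    obtain j where j: "j < m" "ps ! k \<in> E j" "z \<in> E j" using \<delta>(2) z by blast
    from edge_at_vertex[OF k j(1,2)] show ?thesis
    proof
      assume "j = k"
      then show ?thesis using j(3) by (auto simp: mem_polygon_edge edge_vector_def arm_next_def)
    next
      assume *: "(j + 1) mod m = k"
      obtain s where "0 \<le> s" "s \<le> 1" "z = ps ! j + of_real s * edge_vector ps j"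
        using j(3) by (auto simp: mem_polygon_edge)
      then have "z = ps ! k + of_real (1 - s) * arm_prev k" "1 - s \<ge> 0"
        using prev_index[OF k j(1) *] by (auto simp: arm_prev_def edge_vector_def algebra_simps)
      then show ?thesis by blast
    qed
  qed
  then show ?thesis using \<delta>(1) by blast
qed

lemma arms_in_boundary:
  assumes k: "k < m" and s: "0 \<le> s" "s \<le> 1" and d: "d \<in> {arm_next k, arm_prev k}"
  shows "ps ! k + of_real s * d \<in> B"
proof -
  obtain j where j: "j < m" "(j + 1) mod m = k" using prev_index_ex[OF k] .
  have "ps ! k + of_real s * arm_next k \<in> E k"
    using s by (auto simp: mem_polygon_edge edge_vector_def arm_next_def)
  moreover have "ps ! k + of_real s * arm_prev k = ps ! j + of_real (1 - s) * edge_vector ps j"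
    using prev_index[OF k j] by (simp add: arm_prev_def edge_vector_def algebra_simps)
  then have "ps ! k + of_real s * arm_prev k \<in> E j"
    using s unfolding mem_polygon_edge by (intro exI[of _ "1 - s"]) auto
  ultimately show ?thesis using k j d by (auto simp: polygon_boundary_def)
qed

lemma arm_next_nonzero: "k < m \<Longrightarrow> arm_next k \<noteq> 0"
  using edge_vector_nonzero by (simp add: arm_next_def edge_vector_def)

lemma arm_prev_eq:
  assumes "k < m" "j < m" "(j + 1) mod m = k"
  shows "arm_prev k = - edge_vector ps j"
  using prev_index[OF assms] by (simp add: arm_prev_def edge_vector_def)

lemma arm_prev_nonzero: "k < m \<Longrightarrow> arm_prev k \<noteq> 0"
  using prev_index_ex arm_prev_eq edge_vector_nonzero by (metis neg_equal_0_iff_equal)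

text \<open>
  The points with polar coordinates \<open>0 < r < \<epsilon>\<close> and \<open>lo < t < hi\<close> around vertex \<open>k\<close>, where the angle is
  measured from the side towards the next vertex and the radius in multiples of its length.
\<close>
definition sector :: "nat \<Rightarrow> real \<Rightarrow> real \<Rightarrow> real \<Rightarrow> complex set" where
  "sector k \<epsilon> lo hi = (\<lambda>(r, t). ps ! k + of_real r * cis t * arm_next k) ` ({0<..<\<epsilon>} \<times> {lo<..<hi})"

lemma connected_sector: "connected (sector k \<epsilon> lo hi)"
  unfolding sector_def case_prod_unfold
  unfolding cis_conv_exp
  by (intro connected_continuous_image continuous_intros connected_Times connected_Ioo)

text \<open>
  Near a vertex the boundary consists of two rays from it, so a small disc minus the boundary is the
  union of the two sectors between them.
\<close>
lemma sectors_at_vertex: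
  assumes k: "k < m" and \<theta>: "\<theta> = Arg2pi (arm_prev k / arm_next k)" "0 < \<theta>"
  shows "\<exists>\<epsilon>>0. sector k \<epsilon> 0 \<theta> \<inter> B = {} \<and> sector k \<epsilon> \<theta> (2 * pi) \<inter> B = {} \<and>
    ball (ps ! k) (\<epsilon> * norm (arm_next k)) \<subseteq> B \<union> sector k \<epsilon> 0 \<theta> \<union> sector k \<epsilon> \<theta> (2 * pi)"
proof -
  define a where "a = arm_next k"
  define z where "z = arm_prev k / a"
  have a: "a \<noteq> 0" and z: "z \<noteq> 0" "arm_prev k = z * a"
    using k arm_next_nonzero arm_prev_nonzero by (auto simp: a_def z_def)
  have \<theta>': "\<theta> = Arg2pi z" "\<theta> < 2 * pi" "z = of_real (norm z) * cis \<theta>"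
    using \<theta> Arg2pi_lt_2pi[of z] Arg2pi_eq[of z] by (auto simp: a_def z_def cis_conv_exp mult.commute)
  obtain \<delta> where \<delta>: "\<delta> > 0" "\<And>w. w \<in> ball (ps ! k) \<delta> \<Longrightarrow> w \<in> B \<Longrightarrow>
    \<exists>s\<ge>0. w = ps ! k + of_real s * a \<or> w = ps ! k + of_real s * (z * a)"
    using boundary_near_vertex[OF k] unfolding a_def[symmetric] z(2) by blast
  \<comment> \<open>The bounds \<open>1\<close> and \<open>norm z\<close> keep the rays of length \<open>\<epsilon>\<close> within the two sides.\<close>
  define \<epsilon> where "\<epsilon> = min (\<delta> / norm a) (min 1 (norm z))"
  have \<epsilon>: "\<epsilon> > 0" using \<delta> a z by (simp add: \<epsilon>_def)
  have off: "w \<notin> B" if r: "0 < r" "r < \<epsilon>" and t: "0 < t" "t < 2 * pi" "t \<noteq> \<theta>"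
    and w: "w = ps ! k + of_real r * cis t * a" for r t w
  proof
    assume "w \<in> B"
    moreover have "norm (of_real r * cis t * a) < \<delta>"
      using r a by (simp add: norm_mult \<epsilon>_def pos_less_divide_eq)
    then have "w \<in> ball (ps ! k) \<delta>" by (simp add: w dist_norm)
    ultimately obtain s where s: "s \<ge> 0" "w = ps ! k + of_real s * a \<or> w = ps ! k + of_real s * (z * a)"
      using \<delta>(2) by blast
    then have "of_real r * cis t = of_real s \<or> of_real r * cis t = of_real s * z"
      using a by (auto simp: w)
    moreover have t_eq: "Arg2pi (of_real r * cis t) = t"
      using r t by (intro Arg2pi_unique[of r]) (auto simp: cis_conv_exp)
    moreover have "Arg2pi (of_real s) = 0" using s by (simp add: Arg2pi_of_real)
    moreover have "s \<noteq> 0" if "of_real r * cis t = of_real s * z" using that r by auto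
    then have "Arg2pi (of_real s * z) = \<theta>" if "of_real r * cis t = of_real s * z"
      using that s \<theta>' by (simp add: Arg2pi_times_of_real)
    ultimately show False using t by auto
  qed
  have "sector k \<epsilon> 0 \<theta> \<inter> B = {}" "sector k \<epsilon> \<theta> (2 * pi) \<inter> B = {}"
    using off \<theta>(2) \<theta>'(2) by (fastforce simp: sector_def a_def[symmetric])+
  moreover have "w \<in> B \<union> sector k \<epsilon> 0 \<theta> \<union> sector k \<epsilon> \<theta> (2 * pi)"
    if "w \<in> ball (ps ! k) (\<epsilon> * norm a)" for w
  proof -
    define y where "y = (w - ps ! k) / a"
    have w: "w = ps ! k + y * a" using a by (simp add: y_def)
    have "norm y < \<epsilon>" using that a
      by (simp add: y_def norm_divide dist_norm norm_minus_commute pos_divide_less_eq)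
    define t where "t = Arg2pi y"
    have y: "y = of_real (norm y) * cis t" "0 \<le> t" "t < 2 * pi"
      using Arg2pi_eq[of y] Arg2pi_ge_0[of y] Arg2pi_lt_2pi[of y]
      by (auto simp: t_def cis_conv_exp mult.commute)
    consider "t = 0 \<or> y = 0" | "t = \<theta>" | "0 < t" "t < \<theta>" "y \<noteq> 0" | "\<theta> < t" "y \<noteq> 0" using y by linarith
    then show ?thesis
    proof cases
      case 1
      then have "y = of_real (norm y)" using y(1) by auto
      then have "w = ps ! k + of_real (norm y) * arm_next k" using w by (simp add: a_def)
      then show ?thesis using arms_in_boundary[OF k, of "norm y" "arm_next k"] \<open>norm y < \<epsilon>\<close>
        by (simp add: \<epsilon>_def)
    next
      case 2
      have "y = of_real (norm y) * cis \<theta>" using y 2 by simp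
      also have "cis \<theta> = z / of_real (norm z)" using \<theta>'(3) z(1)
        by (metis nonzero_mult_div_cancel_left norm_eq_zero of_real_eq_0_iff)
      finally have "y = of_real (norm y / norm z) * z" by simp
      then have "w = ps ! k + of_real (norm y / norm z) * arm_prev k" unfolding w z(2)
        by (metis mult.assoc)
      moreover have "norm y / norm z \<le> 1" using \<open>norm y < \<epsilon>\<close> z by (simp add: \<epsilon>_def)
      ultimately show ?thesis using arms_in_boundary[OF k, of "norm y / norm z" "arm_prev k"] by simp
    next
      case 3
      then have "w \<in> sector k \<epsilon> 0 \<theta>" unfolding sector_def a_def[symmetric]
        using w y \<open>norm y < \<epsilon>\<close> by (intro image_eqI[of _ _ "(norm y, t)"]) auto
      then show ?thesis by blast
    next
      case 4
      then have "w \<in> sector k \<epsilon> \<theta> (2 * pi)" unfolding sector_def a_def[symmetric]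
        using w y \<open>norm y < \<epsilon>\<close> by (intro image_eqI[of _ _ "(norm y, t)"]) auto
      then show ?thesis by blast
    qed
  qed
  ultimately show ?thesis using \<epsilon> unfolding a_def by blast
qed

lemma internal_angle_alt:
  "internal_angle ps k = (let \<theta> = Arg2pi (arm_prev k / arm_next k) in
     if \<exists>\<epsilon>>0. sector k \<epsilon> 0 \<theta> \<subseteq> polygon_region ps then \<theta> else 2 * pi - \<theta>)"
proof -
  have "sector k \<epsilon> 0 \<theta> \<subseteq> polygon_region ps \<longleftrightarrow> (\<forall>r\<in>{0<..<\<epsilon>}. \<forall>t\<in>{0<..<\<theta>}.
    ps ! k + of_real r * cis t * (next_vertex ps k - ps ! k) \<in> polygon_region ps)" for \<epsilon> \<theta>
    by (auto simp: sector_def arm_next_def image_subset_iff)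
  then show ?thesis unfolding internal_angle_def Let_def arm_prev_def arm_next_def by simp
qed

text \<open>
  The backward extension of either side lies in the sector of angle \<open>3 * pi / 2\<close>, so that sector is
  in the interior. If it is the first one, the definition yields its angle at once. If it is the
  second one, the first sector must not be in the polygon as well: otherwise a whole disc around the
  vertex would be in the polygon, whereas every boundary point is a limit of exterior points.
\<close>
lemma reflex_if_opposite_arm_inside:
  assumes k: "k < m" and ang: "internal_angle ps k \<in> {pi / 2, 3 * pi / 2}"
    and d: "d \<in> {arm_next k, arm_prev k}"
    and l: "l > 0" "\<And>s. 0 < s \<Longrightarrow> s < l \<Longrightarrow> ps ! k - of_real s * d \<in> I"
  shows "internal_angle ps k = 3 * pi / 2"
proof -
  define a where "a = arm_next k"
  define z where "z = arm_prev k / a"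
  define \<theta> where "\<theta> = Arg2pi z"
  define cond where "cond \<longleftrightarrow> (\<exists>\<epsilon>>0. sector k \<epsilon> 0 \<theta> \<subseteq> polygon_region ps)"
  have ia: "internal_angle ps k = (if cond then \<theta> else 2 * pi - \<theta>)"
    unfolding internal_angle_alt Let_def cond_def \<theta>_def z_def a_def by simp
  have a: "a \<noteq> 0" and z: "z \<noteq> 0" "arm_prev k = z * a"
    using k arm_next_nonzero arm_prev_nonzero by (auto simp: a_def z_def)
  have zeq: "z = of_real (norm z) * cis \<theta>"
    using Arg2pi_eq[of z] by (auto simp: \<theta>_def cis_conv_exp mult.commute)
  have \<theta>: "\<theta> = pi / 2 \<or> \<theta> = 3 * pi / 2" using ang ia by (auto split: if_splits)
  then have "0 < \<theta>" using pi_gt_zero by linarith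
  then obtain \<epsilon> where \<epsilon>: "\<epsilon> > 0" "sector k \<epsilon> 0 \<theta> \<inter> B = {}" "sector k \<epsilon> \<theta> (2 * pi) \<inter> B = {}"
    "ball (ps ! k) (\<epsilon> * norm a) \<subseteq> B \<union> sector k \<epsilon> 0 \<theta> \<union> sector k \<epsilon> \<theta> (2 * pi)"
    using sectors_at_vertex[OF k] unfolding \<theta>_def z_def a_def by blast
  have ray: "ps ! k + of_real r * cis t * a \<in> sector k \<epsilon> lo hi" if "0 < r" "r < \<epsilon>" "lo < t" "t < hi" for r t lo hi
    unfolding sector_def a_def using that by (intro image_eqI[of _ _ "(r, t)"]) auto
  \<comment> \<open>In polar coordinates \<open>- d\<close> has angle \<open>f\<close> and radius \<open>c\<close>.\<close>
  define f where "f = (if d = a then pi else if \<theta> = pi / 2 then 3 * pi / 2 else pi / 2)"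
  define c where "c = (if d = a then 1 else norm z)"
  have c: "c > 0" using z by (simp add: c_def)
  have opp: "- d = of_real c * cis f * a"
  proof (cases "d = a")
    case True
    then show ?thesis by (simp add: c_def f_def)
  next
    case False
    then have "d = of_real (norm z) * cis \<theta> * a" using d z zeq by (auto simp: a_def)
    moreover have "cis (3 * pi / 2) = - \<i>"
      using sin_3over2_pi cos_3over2_pi by (simp add: complex_eq_iff algebra_simps)
    from \<theta> this have "cis f = - cis \<theta>"
    proof (elim disjE)
      assume "\<theta> = pi / 2" "cis (3 * pi / 2) = - \<i>"
      then show ?thesis using False unfolding f_def by (metis cis_pi_half)
    next
      assume th: "\<theta> = 3 * pi / 2" "cis (3 * pi / 2) = - \<i>"
      have "3 * pi / 2 \<noteq> pi / 2" using pi_gt_zero by simp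
      then show ?thesis using False th unfolding f_def by (metis cis_pi_half minus_minus)
    qed
    ultimately show ?thesis using False by (simp add: c_def)
  qed
  define r where "r = min (c * l) \<epsilon> / 2"
  have r: "0 < r" "r < \<epsilon>" "r / c < l" "0 < r / c"
    using c l \<epsilon> by (auto simp: r_def min_def field_simps)
  have "ps ! k + of_real r * cis f * a = ps ! k - of_real (r / c) * d"
  proof -
    have "of_real r * cis f * a = of_real (r / c) * (of_real c * cis f * a)" using c by simp
    then show ?thesis unfolding opp[symmetric] by simp
  qed
  then have p_in: "ps ! k + of_real r * cis f * a \<in> I" using l(2)[OF r(4,3)] by argo
  show ?thesis
  proof (cases "\<theta> = pi / 2")
    case False
    then have th: "\<theta> = 3 * pi / 2" using \<theta> by simp
    have "pi / 2 < 3 * pi / 2" "pi < 3 * pi / 2" using pi_gt_zero by linarith+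
    then have "0 < f" "f < \<theta>" using False unfolding th f_def by auto
    then have "sector k \<epsilon> 0 \<theta> \<inter> I \<noteq> {}" using ray[of r 0 f \<theta>] r p_in by blast
    then have "sector k \<epsilon> 0 \<theta> \<subseteq> I" using connected_subset_inside connected_sector \<epsilon> by blast
    then have cond using \<epsilon>(1) by (auto simp: cond_def polygon_region_def)
    then show ?thesis using ia th by simp
  next
    case True
    have "pi / 2 < pi" "pi / 2 < 3 * pi / 2" "pi < 2 * pi" "3 * pi / 2 < 2 * pi"
      using pi_gt_zero by linarith+
    then have "\<theta> < f" "f < 2 * pi" unfolding True f_def by auto
    then have "sector k \<epsilon> \<theta> (2 * pi) \<inter> I \<noteq> {}" using ray[of r \<theta> f "2 * pi"] r p_in by blast
    then have S2: "sector k \<epsilon> \<theta> (2 * pi) \<subseteq> I" using connected_subset_inside connected_sector \<epsilon> by blast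
    have "\<not> cond"
    proof
      assume cond
      then obtain \<epsilon>' where \<epsilon>': "\<epsilon>' > 0" "sector k \<epsilon>' 0 \<theta> \<subseteq> polygon_region ps" by (auto simp: cond_def)
      define w where "w = ps ! k + of_real (min \<epsilon> \<epsilon>' / 2) * cis (\<theta> / 2) * a"
      have "w \<in> sector k \<epsilon>' 0 \<theta>" unfolding w_def sector_def a_def
        using \<epsilon> \<epsilon>' \<open>0 < \<theta>\<close> by (intro image_eqI[of _ _ "(min \<epsilon> \<epsilon>' / 2, \<theta> / 2)"]) (auto simp: min_def)
      moreover have w: "w \<in> sector k \<epsilon> 0 \<theta>" unfolding w_def
        using \<epsilon> \<epsilon>' \<open>0 < \<theta>\<close> by (intro ray) (auto simp: min_def)
      ultimately have "w \<in> I" using \<epsilon> \<epsilon>' by (auto simp: polygon_region_def)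
      then have "sector k \<epsilon> 0 \<theta> \<subseteq> I" using w connected_subset_inside connected_sector \<epsilon> by blast
      then have "ball (ps ! k) (\<epsilon> * norm a) \<subseteq> B \<union> I" using \<epsilon>(4) S2 by blast
      moreover have "ps ! k \<in> closure (outside B)"
        using frontier_outside arms_in_boundary[OF k, of 0 a] by (auto simp: a_def frontier_def)
      then have "ball (ps ! k) (\<epsilon> * norm a) \<inter> outside B \<noteq> {}"
        using \<epsilon>(1) a open_Int_closure_eq_empty[of "ball (ps ! k) (\<epsilon> * norm a)" "outside B"]
          centre_in_ball[of "ps ! k" "\<epsilon> * norm a"] by (metis IntI empty_iff open_ball mult_pos_pos zero_less_norm_iff)
      ultimately show False using inside_Int_outside[of B] outside_no_overlap[of B] by blast
    qed
    then show ?thesis using ia True by simp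
  qed
qed


end

section \<open>Rectilinear polygons as unions of rectangles\<close>

lemma negligible_closed_segment: "negligible (closed_segment a (b :: complex))"
proof (cases "a = b")
  case False
  define c where "c = \<i> * (b - a)"
  have "c \<bullet> x = c \<bullet> a" if "x \<in> closed_segment a b" for x
  proof -
    obtain t where x: "x = a + of_real t * (b - a)"
      using \<open>x \<in> closed_segment a b\<close> by (auto simp: in_segment scaleR_conv_of_real algebra_simps)
    show ?thesis unfolding x c_def inner_complex_def by (simp add: algebra_simps)
  qed
  then have "closed_segment a b \<subseteq> {x. c \<bullet> x = c \<bullet> a}" by blast
  moreover have "c \<noteq> 0" using False by (simp add: c_def)
  ultimately show ?thesis using negligible_hyperplane[of c "c \<bullet> a"] negligible_subset by blast
qed simp

lemma negligible_polygon_boundary: "negligible (polygon_boundary ps)"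
  unfolding polygon_boundary_def polygon_edge_def
  by (intro negligible_Union) (auto simp: negligible_closed_segment)

text \<open>
  The unit vector \<open>dir\<close> of the first side plays the role of the horizontal direction. Instead of the
  polygon, only its interior is turned: \<open>U\<close> is the interior in the coordinates with first axis \<open>dir\<close>.
\<close>
locale right_angled_polygon = simple_closed_polygon +
  assumes right_angles: "\<And>k. k < m \<Longrightarrow> internal_angle ps k \<in> {pi / 2, 3 * pi / 2}"
begin

lemma arms_perpendicular:
  assumes k: "k < m"
  shows "Re (arm_prev k / arm_next k) = 0"
proof -
  define z where "z = arm_prev k / arm_next k"
  have "Arg2pi z = pi / 2 \<or> Arg2pi z = 3 * pi / 2"
    using right_angles[OF k] unfolding internal_angle_alt Let_def z_def by (auto split: if_splits)
  moreover have "cos (3 * pi / 2) = 0" using cos_3over2_pi by (simp add: algebra_simps)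
  ultimately have "cos (Arg2pi z) = 0" using cos_pi_half by metis
  moreover have "z = of_real (norm z) * cis (Arg2pi z)"
    using Arg2pi_eq[of z] by (auto simp: cis_conv_exp mult.commute)
  then have "Re z = Re (of_real (norm z) * cis (Arg2pi z))" by simp
  then have "Re z = norm z * cos (Arg2pi z)" by simp
  ultimately show ?thesis by (simp add: z_def)
qed

definition dir :: complex where "dir = sgn (edge_vector ps 0)"

lemma norm_dir: "norm dir = 1"
  proof -
  have "edge_vector ps 0 \<noteq> 0" using length_ge_3 by (intro edge_vector_nonzero) linarith
  then show ?thesis by (simp add: dir_def norm_sgn)
qed

lemma dir_cancel [simp]: "dir * (cnj dir * z) = z" "cnj dir * (dir * z) = z" "dir * cnj dir = 1"
proof -
  show *: "dir * cnj dir = 1" using norm_dir complex_norm_square[of dir] by simp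
  have "dir * (cnj dir * z) = (dir * cnj dir) * z" by (rule mult.assoc[symmetric])
  then show 1: "dir * (cnj dir * z) = z" by (simp only: * mult_1)
  show "cnj dir * (dir * z) = z" using 1 by (simp only: mult.left_commute)
qed

lemma edge_direction:
  assumes "k < m"
  shows "\<exists>r. edge_vector ps k = of_real r * dir \<or> edge_vector ps k = of_real r * \<i> * dir"
  using assms
proof (induction k)
  case 0
  have "edge_vector ps 0 = of_real (norm (edge_vector ps 0)) * dir"
    using edge_vector_nonzero[OF 0] by (simp add: dir_def sgn_eq)
  then show ?case by blast
next
  case (Suc k)
  then have k: "k < m" "(k + 1) mod m = Suc k" by auto
  have "arm_prev (Suc k) / arm_next (Suc k) = - edge_vector ps k / edge_vector ps (Suc k)"
    using arm_prev_eq[OF Suc.prems k] by (simp add: arm_next_def edge_vector_def)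
  then have "Re (edge_vector ps k / edge_vector ps (Suc k)) = 0"
    using arms_perpendicular[OF Suc.prems] by simp
  then obtain y where y: "edge_vector ps k / edge_vector ps (Suc k) = of_real y * \<i>"
    by (metis complex_is_Real_iff complex_eq add.left_neutral mult.commute of_real_0)
  have nz: "edge_vector ps k \<noteq> 0" "edge_vector ps (Suc k) \<noteq> 0"
    using edge_vector_nonzero k Suc.prems by auto
  with y have "y \<noteq> 0" by auto
  with y nz have eq: "edge_vector ps (Suc k) = - of_real (1 / y) * \<i> * edge_vector ps k"
    by (simp add: field_simps)
  obtain r where "edge_vector ps k = of_real r * dir \<or> edge_vector ps k = of_real r * \<i> * dir"
    using Suc k by auto
  then show ?case
  proof
    assume "edge_vector ps k = of_real r * dir"
    then have "edge_vector ps (Suc k) = of_real (- r / y) * \<i> * dir" using eq by simp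
    then show ?thesis by blast
  next
    assume "edge_vector ps k = of_real r * \<i> * dir"
    then have "edge_vector ps (Suc k) = - (\<i> * \<i>) * of_real (r / y) * dir"
      using eq by (simp add: algebra_simps)
    then have "edge_vector ps (Suc k) = of_real (r / y) * dir" by simp
    then show ?thesis by blast
  qed
qed

definition U :: "complex set" where "U = {z. dir * z \<in> I}"

lemma U_eq_image: "U = (*) (cnj dir) ` I"
proof
  show "U \<subseteq> (*) (cnj dir) ` I"
  proof
    fix z assume "z \<in> U"
    then show "z \<in> (*) (cnj dir) ` I" by (intro image_eqI[of _ _ "dir * z"]) (simp_all add: U_def)
  qed
qed (auto simp: U_def)

lemma open_U: "open U"
proof -
  have "open ((*) dir -` I)"
    using open_inside_poly by (intro open_vimage continuous_intros)
  moreover have "U = (*) dir -` I" by (auto simp: U_def)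
  ultimately show ?thesis by simp
qed

lemma bounded_U: "bounded U"
  unfolding U_eq_image using bounded_inside_poly
  by (intro bounded_linear_image bounded_linear_mult_right)

lemma connected_U: "connected U"
  unfolding U_eq_image using connected_inside_poly
  by (intro connected_continuous_image continuous_intros)

lemma not_inside_and_boundary: "z \<in> I \<Longrightarrow> z \<notin> B"
  using inside_no_overlap by blast

lemma chord_end_in_boundary:
  assumes q: "q \<notin> U" and \<sigma>: "\<bar>\<sigma>\<bar> = 1" and l: "l > 0"
    and approach: "\<And>s. 0 < s \<Longrightarrow> s < l \<Longrightarrow> q + of_real (\<sigma> * s) \<in> U"
  shows "dir * q \<in> B"
proof -
  have "dir * q \<in> closure I" unfolding closure_approachable
  proof (intro allI impI)
    fix e :: real assume "e > 0"
    define s where "s = min l e / 2"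
    have s: "0 < s" "s < l" "s < e" using l \<open>e > 0\<close> by (auto simp: s_def)
    have "dir * (q + of_real (\<sigma> * s)) \<in> I" using approach[OF s(1,2)] by (simp add: U_def)
    moreover have "dist (dir * (q + of_real (\<sigma> * s))) (dir * q) < e"
      using s \<sigma> by (simp add: dist_norm distrib_left norm_mult norm_dir abs_mult)
    ultimately show "\<exists>y\<in>I. dist y (dir * q) < e" by blast
  qed
  then show ?thesis
    using q closure_inside by (auto simp: U_def polygon_region_def)
qed

text \<open>
  One of the two sides at a vertex is horizontal. It cannot point into the chord that ends at the
  vertex, as the chord is in the interior; so it points the other way.
\<close>
lemma arm_along_chord:
  assumes k: "k < m" and \<sigma>: "\<bar>\<sigma>\<bar> = 1" and l: "l > 0" and q: "dir * q = ps ! k"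
    and approach: "\<And>s. 0 < s \<Longrightarrow> s < l \<Longrightarrow> q + of_real (\<sigma> * s) \<in> U"
  shows "\<exists>d\<in>{arm_next k, arm_prev k}. \<exists>r>0. d = - of_real (\<sigma> * r) * dir"
proof -
  have nz: "arm_next k \<noteq> 0" "arm_prev k \<noteq> 0" using arm_next_nonzero arm_prev_nonzero k by auto
  have "\<exists>d\<in>{arm_next k, arm_prev k}. \<exists>\<rho>. d = of_real \<rho> * dir"
  proof -
    obtain r where r: "arm_next k = of_real r * dir \<or> arm_next k = of_real r * \<i> * dir"
      using edge_direction[OF k] by (auto simp: arm_next_def edge_vector_def)
    obtain y where "arm_prev k / arm_next k = of_real y * \<i>"
      using arms_perpendicular[OF k] by (metis add.left_neutral complex_eq mult.commute of_real_0)
    then have y: "arm_prev k = of_real y * \<i> * arm_next k" using nz by (simp add: field_simps)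
    from r show ?thesis
    proof
      assume *: "arm_next k = of_real r * \<i> * dir"
      have "arm_prev k = (\<i> * \<i>) * of_real (y * r) * dir"
        unfolding y * by (simp add: mult_ac del: i_squared)
      then have "arm_prev k = of_real (- y * r) * dir" by simp
      then show ?thesis by blast
    qed blast
  qed
  then obtain d \<rho> where d: "d \<in> {arm_next k, arm_prev k}" "d = of_real \<rho> * dir" by blast
  then have "\<rho> \<noteq> 0" using nz by auto
  have "\<rho> \<noteq> \<sigma> * \<bar>\<rho>\<bar>"
  proof
    assume *: "\<rho> = \<sigma> * \<bar>\<rho>\<bar>"
    define t where "t = min 1 (l / (2 * \<bar>\<rho>\<bar>))"
    have "t * \<bar>\<rho>\<bar> \<le> l / (2 * \<bar>\<rho>\<bar>) * \<bar>\<rho>\<bar>" by (intro mult_right_mono) (auto simp: t_def)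
    then have t: "0 < t" "t \<le> 1" "t * \<bar>\<rho>\<bar> < l" using \<open>\<rho> \<noteq> 0\<close> l by (auto simp: t_def)
    then have "q + of_real (\<sigma> * (t * \<bar>\<rho>\<bar>)) \<in> U" using \<open>\<rho> \<noteq> 0\<close> by (intro approach) auto
    moreover have "\<sigma> * (t * \<bar>\<rho>\<bar>) = t * \<rho>" using * by (metis mult.left_commute)
    ultimately have "dir * q + of_real t * d \<in> I"
      using d(2) by (simp add: U_def algebra_simps)
    moreover have "dir * q + of_real t * d \<in> B" unfolding q
      using arms_in_boundary[OF k _ _ d(1)] t by simp
    ultimately show False using not_inside_and_boundary by blast
  qed
  then have "\<rho> = - (\<sigma> * \<bar>\<rho>\<bar>)" using \<sigma> by (auto simp: abs_if split: if_splits)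
  then have "d = - of_real (\<sigma> * \<bar>\<rho>\<bar>) * dir" using d(2) by (metis of_real_minus)
  then show ?thesis using d(1) \<open>\<rho> \<noteq> 0\<close> by (metis zero_less_abs_iff)
qed

text \<open>
  At a vertex, the chord is the backward extension of the horizontal side, so the vertex is reflex. A
  boundary point that is not a vertex lies on a vertical side, since the chord would run into a
  horizontal one. Then the half square \<open>H'\<close> on the side of the chord avoids the boundary and meets
  the interior.
\<close>
lemma chord_end_clean_or_reflex:
  assumes q: "q \<notin> U" and \<sigma>: "\<bar>\<sigma>\<bar> = 1" and l: "l > 0"
    and approach: "\<And>s. 0 < s \<Longrightarrow> s < l \<Longrightarrow> q + of_real (\<sigma> * s) \<in> U"
  shows "clean_end U \<sigma> q \<or> dir * q \<in> reflex_vertices ps"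
proof (cases "dir * q \<in> set ps")
  case True
  then obtain k where k: "k < m" "dir * q = ps ! k" by (metis in_set_conv_nth)
  obtain d r where d: "d \<in> {arm_next k, arm_prev k}" "r > 0" "d = - of_real (\<sigma> * r) * dir"
    using arm_along_chord[OF k(1) \<sigma> l k(2) approach] by blast
  have "internal_angle ps k = 3 * pi / 2"
  proof (rule reflex_if_opposite_arm_inside[OF k(1) right_angles[OF k(1)] d(1)])
    show "l / r > 0" using l d by simp
    fix s assume s: "0 < s" "s < l / r"
    then have "q + of_real (\<sigma> * (s * r)) \<in> U"
      using d by (intro approach) (auto simp: pos_less_divide_eq)
    moreover have "dir * (q + of_real (\<sigma> * (s * r))) = ps ! k - of_real s * d"
      unfolding d(3) k(2)[symmetric] by (simp add: algebra_simps)
    ultimately show "ps ! k - of_real s * d \<in> I" by (simp add: U_def)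
  qed
  then show ?thesis using k by (auto simp: reflex_vertices_def)
next
  case False
  have "dir * q \<in> B" using chord_end_in_boundary[OF assms] .
  then obtain k where k: "k < m" "dir * q \<in> E k" by (auto simp: polygon_boundary_def)
  define e where "e = edge_vector ps k"
  have e: "e \<noteq> 0" using edge_vector_nonzero[OF k(1)] by (simp add: e_def)
  obtain \<delta> where \<delta>: "\<delta> > 0" "\<And>z. z \<in> ball (dir * q) \<delta> \<Longrightarrow> z \<in> B \<longleftrightarrow> Im ((z - dir * q) / e) = 0"
    using boundary_near_nonvertex[OF k False] unfolding e_def by blast
  have near: "dir * w \<in> B \<longleftrightarrow> Im (dir * (w - q) / e) = 0" if "norm (w - q) < \<delta>" for w
    using \<delta>(2)[of "dir * w"] that
    by (simp add: dist_norm norm_minus_commute right_diff_distrib[symmetric] norm_mult norm_dir)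
  have dir0: "dir \<noteq> 0" using norm_dir by auto
  obtain r where r: "e = of_real r * dir \<or> e = of_real r * \<i> * dir"
    using edge_direction[OF k(1)] by (auto simp: e_def)
  have "e \<noteq> of_real r * dir"
  proof
    assume *: "e = of_real r * dir"
    define s where "s = min l \<delta> / 2"
    have s: "0 < s" "s < l" "s < \<delta>" using l \<delta> by (auto simp: s_def)
    have "dir * of_real (\<sigma> * s) / e = of_real (\<sigma> * s / r)" using * dir0 by simp
    moreover have "norm (of_real (\<sigma> * s) :: complex) < \<delta>"
      using s \<sigma> by (simp only: norm_of_real abs_mult)
    ultimately have "dir * (q + of_real (\<sigma> * s)) \<in> B"
      using near[of "q + of_real (\<sigma> * s)"] by (simp only: add_diff_cancel_left' Im_complex_of_real)
    then show False using approach[OF s(1,2)] not_inside_and_boundary by (auto simp: U_def)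
  qed
  then have e_eq: "e = of_real r * \<i> * dir" "r \<noteq> 0" using r e by auto
  have near': "dir * w \<in> B \<longleftrightarrow> Re w = Re q" if "norm (w - q) < \<delta>" for w
  proof -
    have "dir * (w - q) / e = - \<i> * (w - q) / of_real r"
      using e_eq dir0 by (simp add: field_simps)
    then have "Im (dir * (w - q) / e) = - (Re (w - q) / r)" by simp
    then show ?thesis using near[OF that] e_eq(2) by simp
  qed
  define H where "H = {w. \<bar>Re w - Re q\<bar> < \<delta> / 2 \<and> \<bar>Im w - Im q\<bar> < \<delta> / 2}"
  have H: "norm (w - q) < \<delta>" if "w \<in> H" for w
    using that cmod_le[of "w - q"] by (auto simp: H_def)
  have H_box: "H = box (q - Complex (\<delta> / 2) (\<delta> / 2)) (q + Complex (\<delta> / 2) (\<delta> / 2))"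
    unfolding set_eq_iff H_def mem_Collect_eq in_box_complex_iff abs_diff_less_iff by auto
  define H' where "H' = H \<inter> {w. (of_real \<sigma> :: complex) \<bullet> w > \<sigma> * Re q}"
  have "convex H'" unfolding H'_def H_box by (intro convex_Int convex_box convex_halfspace_gt)
  then have "connected ((*) dir ` H')"
    by (intro connected_continuous_image continuous_intros convex_connected)
  moreover have side: "\<sigma> * (Re w - Re q) > 0" if "w \<in> H'" for w
    using that by (simp add: H'_def inner_complex_def algebra_simps)
  then have "(*) dir ` H' \<inter> B = {}" using near' H by (force simp: H'_def)
  moreover have "(*) dir ` H' \<inter> I \<noteq> {}"
  proof -
    define s where "s = min l (\<delta> / 2) / 2"
    have s: "0 < s" "s < l" "s < \<delta> / 2" using l \<delta> by (auto simp: s_def)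
    have "\<sigma> * \<sigma> = 1" using \<sigma> by (metis abs_mult_self_eq mult_1)
    then have ss: "\<sigma> * (\<sigma> * s) = s" by (metis mult.assoc mult_1)
    then have "q + of_real (\<sigma> * s) \<in> H'"
      using s \<sigma> by (simp add: H'_def H_def inner_complex_def abs_mult distrib_left ss)
    moreover have "dir * (q + of_real (\<sigma> * s)) \<in> I" using approach[OF s(1,2)] by (simp add: U_def)
    ultimately show ?thesis by blast
  qed
  ultimately have inI: "(*) dir ` H' \<subseteq> I" by (rule connected_subset_inside)
  have "clean_end U \<sigma> q" unfolding clean_end_def
  proof (intro exI[of _ "\<delta> / 2"] conjI allI impI)
    fix w assume w: "\<bar>Re w - Re q\<bar> < \<delta> / 2" "\<bar>Im w - Im q\<bar> < \<delta> / 2"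
    then have "w \<in> H" by (simp add: H_def)
    {
      assume "\<sigma> * (Re w - Re q) > 0"
      then have "w \<in> H'" using \<open>w \<in> H\<close> by (simp add: H'_def inner_complex_def algebra_simps)
      then show "w \<in> U" using inI by (auto simp: U_def)
    next
      assume "Re w = Re q"
      then have "dir * w \<in> B" using near' H \<open>w \<in> H\<close> by blast
      then show "w \<notin> U" using not_inside_and_boundary by (auto simp: U_def)
    }
  qed (use \<delta> in auto)
  then show ?thesis ..
qed

lemma chord_left_approach:
  "chord U (a, b, y) \<Longrightarrow> 0 < s \<Longrightarrow> s < b - a \<Longrightarrow> Complex a y + of_real (1 * s) \<in> U"
  using subsetD[of "hseg (a, b, y)" U "Complex a y + of_real (1 * s)"] by (simp add: chord_def)

lemma chord_right_approach:
  "chord U (a, b, y) \<Longrightarrow> 0 < s \<Longrightarrow> s < b - a \<Longrightarrow> Complex b y + of_real (- 1 * s) \<in> U"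
  using subsetD[of "hseg (a, b, y)" U "Complex b y + of_real (- 1 * s)"] by (simp add: chord_def)

text \<open>
  If chords arrived at a vertex from both sides, its two sides would be opposite to each other,
  contrary to the right angle.
\<close>
sublocale chord_domain U "(*) (cnj dir) ` reflex_vertices ps"
proof
  show "open U" "bounded U" "connected U" by (rule open_U bounded_U connected_U)+
  have "reflex_vertices ps \<subseteq> set ps" by (auto simp: reflex_vertices_def)
  then show "finite ((*) (cnj dir) ` reflex_vertices ps)" by (simp add: finite_subset)
next
  fix a b y assume c: "chord U (a, b, y)"
  have mem: "z \<in> (*) (cnj dir) ` reflex_vertices ps" if "dir * z \<in> reflex_vertices ps" for z
    using that by (intro image_eqI[of _ _ "dir * z"]) auto
  have "clean_end U 1 (Complex a y) \<or> dir * Complex a y \<in> reflex_vertices ps"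
    using c by (intro chord_end_clean_or_reflex[of _ _ "b - a"] chord_left_approach[OF c]) (auto simp: chord_def)
  then show "clean_end U 1 (Complex a y) \<or> Complex a y \<in> (*) (cnj dir) ` reflex_vertices ps"
    using mem by blast
  have "clean_end U (- 1) (Complex b y) \<or> dir * Complex b y \<in> reflex_vertices ps"
    using c by (intro chord_end_clean_or_reflex[of _ _ "b - a"] chord_right_approach[OF c]) (auto simp: chord_def)
  then show "clean_end U (- 1) (Complex b y) \<or> Complex b y \<in> (*) (cnj dir) ` reflex_vertices ps"
    using mem by blast
next
  fix a b c y assume ch: "chord U (a, b, y)" "chord U (b, c, y)"
  show "Complex b y \<notin> (*) (cnj dir) ` reflex_vertices ps"
  proof
    assume "Complex b y \<in> (*) (cnj dir) ` reflex_vertices ps"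
    then obtain k where k: "k < m" "dir * Complex b y = ps ! k"
      by (auto simp: reflex_vertices_def)
    have "a < b" "b < c" using ch by (auto simp: chord_def)
    have "\<exists>d\<in>{arm_next k, arm_prev k}. \<exists>r>0. d = - of_real (- 1 * r) * dir"
      by (rule arm_along_chord[OF k(1) _ _ k(2) chord_right_approach[OF ch(1)]])
        (use \<open>a < b\<close> in simp_all)
    then obtain d r where d: "d \<in> {arm_next k, arm_prev k}" "r > 0" "d = - of_real (- 1 * r) * dir"
      by blast
    have "\<exists>d\<in>{arm_next k, arm_prev k}. \<exists>r>0. d = - of_real (1 * r) * dir"
      by (rule arm_along_chord[OF k(1) _ _ k(2) chord_left_approach[OF ch(2)]])
        (use \<open>b < c\<close> in simp_all)
    then obtain d' r' where d': "d' \<in> {arm_next k, arm_prev k}" "r' > 0" "d' = - of_real (1 * r') * dir"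
      by blast
    have dir0: "dir \<noteq> 0" using norm_dir by auto
    have ratio: "d / d' = of_real (- r / r')" "d' / d = of_real (- r' / r)"
      using d d' dir0 by (auto simp: field_simps)
    have "d \<noteq> d'"
    proof
      assume "d = d'"
      then have "d / d' = 1" using d' dir0 by auto
      then have "- r / r' = 1" using ratio(1) by (metis of_real_eq_1_iff)
      then show False using d d' by (simp add: field_simps)
    qed
    then have "arm_prev k / arm_next k = d / d' \<or> arm_prev k / arm_next k = d' / d" using d(1) d'(1) by auto
    then have "Re (arm_prev k / arm_next k) \<noteq> 0" using ratio d(2) d'(2) by auto
    then show False using arms_perpendicular[OF k(1)] by simp
  qed
qed

lemma polygon_into_boxes:
  "\<exists>\<D>. finite \<D> \<and> \<D> \<noteq> {} \<and> card \<D> \<le> card (reflex_vertices ps) + 1 \<and> disjoint \<D> \<and>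
    (\<forall>D\<in>\<D>. D \<noteq> {} \<and> (\<exists>p q. D = box p q) \<and> (*) dir ` closure D \<subseteq> polygon_region ps) \<and>
    negligible (polygon_region ps - (*) dir ` \<Union>\<D>)"
proof -
  have inj: "inj ((*) (cnj dir))" by (rule injI) (metis dir_cancel(1))
  obtain \<D> where D: "finite \<D>" "card \<D> \<le> card ((*) (cnj dir) ` reflex_vertices ps) + 1"
    "\<forall>D\<in>\<D>. D \<subseteq> U \<and> D \<noteq> {} \<and> (\<exists>p q. D = box p q)" "disjoint \<D>" "negligible (U - \<Union>\<D>)"
    using box_decomposition by blast
  have "card ((*) (cnj dir) ` reflex_vertices ps) = card (reflex_vertices ps)"
    by (rule card_image[OF inj_on_subset[OF inj subset_UNIV]])
  moreover have "\<D> \<noteq> {}"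
  proof
    assume "\<D> = {}"
    then have "negligible U" using D(5) by simp
    then have "U = {}" using open_U open_not_negligible by blast
    then show False using inside_nonempty by (simp add: U_eq_image)
  qed
  moreover have "(*) dir ` closure D \<subseteq> polygon_region ps" if "D \<in> \<D>" for D
  proof -
    have "(*) dir ` closure D \<subseteq> closure ((*) dir ` D)"
      by (intro continuous_image_closure_subset[of UNIV] continuous_intros) auto
    also have "(*) dir ` D \<subseteq> I" using D(3) that by (auto simp: U_def)
    then have "closure ((*) dir ` D) \<subseteq> closure I" by (rule closure_mono)
    finally show ?thesis unfolding closure_inside .
  qed
  moreover have "negligible (polygon_region ps - (*) dir ` \<Union>\<D>)"
  proof -
    have "negligible ((*) dir ` (U - \<Union>\<D>))"
      by (rule negligible_differentiable_image_negligible[OF order_refl D(5)])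
        (auto intro!: derivative_intros)
    then have "negligible (B \<union> (*) dir ` (U - \<Union>\<D>))"
      using negligible_polygon_boundary by simp
    moreover have "polygon_region ps - (*) dir ` \<Union>\<D> \<subseteq> B \<union> (*) dir ` (U - \<Union>\<D>)"
    proof
      fix z assume z: "z \<in> polygon_region ps - (*) dir ` \<Union>\<D>"
      have zz: "z = dir * (cnj dir * z)" by simp
      show "z \<in> B \<union> (*) dir ` (U - \<Union>\<D>)"
      proof (cases "z \<in> B")
        case False
        then have "cnj dir * z \<in> U" using z by (auto simp: U_def polygon_region_def)
        moreover have "cnj dir * z \<notin> \<Union>\<D>" using z zz by (metis DiffD2 image_eqI)
        ultimately show ?thesis using zz by blast
      qed simp
    qed
    ultimately show ?thesis by (rule negligible_subset)
  qed
  ultimately show ?thesis using D by (intro exI[of _ \<D>]) auto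
qed

end

theorem rectilinear_polygon_into_boxes:
  assumes "rectilinear_polygon ps"
  obtains u \<D> where "norm u = 1" "finite \<D>" "\<D> \<noteq> {}" "disjoint \<D>"
    "card \<D> \<le> card (reflex_vertices ps) + 1"
    "\<And>D. D \<in> \<D> \<Longrightarrow> D \<noteq> {} \<and> (\<exists>p q. D = box p q) \<and> (*) u ` closure D \<subseteq> polygon_region ps"
    "negligible (polygon_region ps - (*) u ` \<Union>\<D>)"
proof -
  interpret right_angled_polygon ps
    using assms by unfold_locales (auto simp: rectilinear_polygon_def)
  show thesis using polygon_into_boxes norm_dir that by metis
qed

lemma polygon_region_compact_nonnull:
  assumes "simple_polygon ps"
  shows "compact (polygon_region ps)" "\<not> negligible (polygon_region ps)"
proof -
  interpret simple_closed_polygon ps using assms by unfold_locales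
  show "compact (polygon_region ps)"
    unfolding closure_inside[symmetric] using bounded_inside_poly by simp
  have "\<not> negligible I" using open_not_negligible[OF open_inside_poly inside_nonempty] .
  then show "\<not> negligible (polygon_region ps)"
    using negligible_subset[of "polygon_region ps" I] by (auto simp: polygon_region_def)
qed

section \<open>Values of rectangles and the division\<close>

text \<open>
  Hyperplanes are null sets, so the integrands converge almost everywhere and dominated convergence
  applies.
\<close>
lemma value_up_to_hyperplane_continuous:
  fixes f :: "'a::euclidean_space \<Rightarrow> real" and u :: 'a
  assumes f: "integrable lebesgue f" and u: "u \<noteq> 0"
  shows "continuous_on UNIV (\<lambda>t. LINT z|lebesgue. indicator {z. u \<bullet> z \<le> t} z * f z)"
proof -
  have half: "{z. u \<bullet> z \<le> t} \<in> sets lebesgue" for t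
    using closed_halfspace_le[of u t] by (simp add: borel_closed)
  have "(\<lambda>k. LINT z|lebesgue. indicator {z. u \<bullet> z \<le> X k} z * f z) \<longlonglongrightarrow>
      (LINT z|lebesgue. indicator {z. u \<bullet> z \<le> t} z * f z)" if X: "X \<longlonglongrightarrow> t" for X t
  proof (rule integral_dominated_convergence[where w = "\<lambda>z. norm (f z)"])
    have "{z. u \<bullet> z = t} \<in> null_sets lebesgue"
      using negligible_hyperplane[of u t] u by (simp add: negligible_iff_null_sets)
    then have "AE z in lebesgue. z \<notin> {z. u \<bullet> z = t}" by (rule AE_not_in)
    then show "AE z in lebesgue. (\<lambda>k. indicator {z. u \<bullet> z \<le> X k} z * f z) \<longlonglongrightarrow>
        indicator {z. u \<bullet> z \<le> t} z * f z"
    proof (rule AE_mp, intro AE_I2 impI)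
      fix z assume "z \<notin> {z. u \<bullet> z = t}"
      then consider "u \<bullet> z < t" | "t < u \<bullet> z" by fastforce
      then have "eventually (\<lambda>k. indicator {z. u \<bullet> z \<le> X k} z * f z = indicator {z. u \<bullet> z \<le> t} z * f z) sequentially"
      proof cases
        case 1
        from order_tendstoD(1)[OF X 1] show ?thesis
          by eventually_elim (use 1 in auto)
      next
        case 2
        from order_tendstoD(2)[OF X 2] show ?thesis
          by eventually_elim (use 2 in auto)
      qed
      then show "(\<lambda>k. indicator {z. u \<bullet> z \<le> X k} z * f z) \<longlonglongrightarrow> indicator {z. u \<bullet> z \<le> t} z * f z"
        by (rule tendsto_eventually)
    qed
    show "integrable lebesgue (\<lambda>z. norm (f z))" using f by simp
    show "AE z in lebesgue. norm (indicator {z. u \<bullet> z \<le> X k} z * f z) \<le> norm (f z)" for k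
      by (auto simp: indicator_def)
    show "(\<lambda>z. indicator {z. u \<bullet> z \<le> t} z * f z) \<in> borel_measurable lebesgue"
      "(\<lambda>z. indicator {z. u \<bullet> z \<le> X k} z * f z) \<in> borel_measurable lebesgue" for k
      using half f by (auto intro!: borel_measurable_times borel_measurable_indicator)
  qed
  then show ?thesis
    unfolding continuous_on_eq_continuous_at[OF open_UNIV] continuous_at_sequentially comp_def by blast
qed

text \<open>
  The moving knife needs agents with a positive total value. An agent who values everything at zero
  is satisfied by any rectangle and may be treated as if the value were area.
\<close>
lemma positive_value_density:
  assumes V: "value_measure C V" and C: "compact C" "\<not> negligible C" and "\<kappa> \<ge> 0"
  obtains w where "\<forall>x\<in>C. 0 \<le> w x" "set_integrable lebesgue C w" "(LINT x:C|lebesgue. w x) > 0"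
    "\<And>Z. Z \<in> sets lebesgue \<Longrightarrow> Z \<subseteq> C \<Longrightarrow>
      \<kappa> * (LINT x:C|lebesgue. w x) \<le> (LINT x:Z|lebesgue. w x) \<Longrightarrow> \<kappa> * V C \<le> V Z"
proof -
  have Cl: "C \<in> lmeasurable" using C(1) by (rule lmeasurable_compact)
  obtain v where v: "\<forall>x\<in>C. 0 \<le> v x" "set_integrable lebesgue C v"
    "\<And>Z. Z \<in> sets lebesgue \<Longrightarrow> Z \<subseteq> C \<Longrightarrow> V Z = (LINT x:Z|lebesgue. v x)"
    using V unfolding value_measure_def by blast
  have nonneg: "(LINT x:Z|lebesgue. v x) \<ge> 0" if "Z \<subseteq> C" for Z
    unfolding set_lebesgue_integral_def using v(1) that
    by (intro integral_nonneg_AE AE_I2) (auto simp: indicator_def)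
  have VC: "V C = (LINT x:C|lebesgue. v x)" using v(3)[of C] Cl by blast
  show thesis
  proof (cases "V C > 0")
    case True
    show thesis by (rule that[of v]) (use True v VC in auto)
  next
    case False
    then have "V C = 0" using nonneg[of C] VC by simp
    have "set_integrable lebesgue C (\<lambda>x. 1 :: real)"
      using Cl by (auto simp: set_integrable_def fmeasurable_def intro!: integrable_real_indicator)
    moreover have "(LINT x:C|lebesgue. 1 :: real) = measure lebesgue C"
      using Cl by (simp add: set_lebesgue_integral_def)
    moreover have "measure lebesgue C \<noteq> 0"
      using C(2) Cl negligible_iff_measure by blast
    then have "measure lebesgue C > 0" by (simp add: zero_less_measure_iff)
    ultimately show thesis
      using v(3) nonneg \<open>V C = 0\<close> by (intro that[of "\<lambda>_. 1"]) auto
  qed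
qed

lemma rectangle_rotated_cbox:
  assumes "norm u = 1" "Re p < Re q" "Im p < Im q"
  shows "rectangle ((*) u ` cbox p q)"
proof -
  have "cbox p q = (\<lambda>z. p + z) ` cbox 0 (q - p)"
    using cbox_translation[of p 0 "q - p"] by simp
  also have "q - p = Complex (Re (q - p)) (Im (q - p))" by (rule complex_surj[symmetric])
  finally have "(*) u ` cbox p q = (\<lambda>z. u * p + u * z) ` cbox 0 (Complex (Re (q - p)) (Im (q - p)))"
    by (simp add: image_image distrib_left)
  then show ?thesis unfolding rectangle_def using assms
    by (intro exI[of _ "u * p"] exI[of _ u] exI[of _ "Re (q - p)"] exI[of _ "Im (q - p)"]) simp
qed

theorem theorem7p1:
  fixes ps :: "complex list" and C :: "complex set" and T n :: nat
    and V :: "nat \<Rightarrow> complex set \<Rightarrow> real"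
  assumes "rectilinear_polygon ps"
    and "C = polygon_region ps"
    and "T = card (reflex_vertices ps)"
    and "n \<ge> 1"
    and "\<And>i. i \<in> {1..n} \<Longrightarrow> value_measure C (V i)"
  shows "\<exists>Z :: nat \<Rightarrow> complex set.
           (\<forall>i\<in>{1..n}. rectangle (Z i) \<and> Z i \<subseteq> C) \<and>
           (\<forall>i\<in>{1..n}. \<forall>j\<in>{1..n}. i \<noteq> j \<longrightarrow> interior (Z i) \<inter> interior (Z j) = {}) \<and>
           (\<forall>i\<in>{1..n}. V i (Z i) \<ge> 1 / (real n + real T) * V i C)"
proof -
  obtain u \<D> where u: "norm u = 1" and \<D>: "finite \<D>" "\<D> \<noteq> {}" "disjoint \<D>" "card \<D> \<le> T + 1"
    and boxes: "\<And>D. D \<in> \<D> \<Longrightarrow> D \<noteq> {} \<and> (\<exists>p q. D = box p q) \<and> (*) u ` closure D \<subseteq> C"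
    and rest: "negligible (C - (*) u ` \<Union>\<D>)"
    unfolding assms(2,3) by (rule rectilinear_polygon_into_boxes[OF assms(1)]) blast
  have "simple_polygon ps" using assms(1) by (simp add: rectilinear_polygon_def)
  then have C: "compact C" "\<not> negligible C"
    unfolding assms(2) by (rule polygon_region_compact_nonnull)+
  have u0: "u \<noteq> 0" using u by auto
  have inj_u: "inj ((*) u)" using u0 by (simp add: inj_on_def)
  have lin_u: "linear ((*) u)" by (intro bounded_linear.linear bounded_linear_mult_right)
  have inner_u: "u \<bullet> (u * z) = Re z" for z
  proof -
    have "u \<bullet> (u * z) = (Re u * Re u + Im u * Im u) * Re z"
      by (simp add: inner_complex_def algebra_simps)
    also have "Re u * Re u + Im u * Im u = 1" using u by (simp add: cmod_def power2_eq_square)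
    finally show ?thesis by simp
  qed
  obtain p q where pq: "\<And>D. D \<in> \<D> \<Longrightarrow> box (p D) (q D) = D" using boxes by metis
  have lt: "Re (p D) < Re (q D)" "Im (p D) < Im (q D)" if D: "D \<in> \<D>" for D
  proof -
    obtain y where "y \<in> box (p D) (q D)" using boxes[OF D] pq[OF D] by auto
    then show "Re (p D) < Re (q D)" "Im (p D) < Im (q D)" by (auto simp: in_box_complex_iff)
  qed
  have in_C: "(*) u ` cbox (p D) (q D) \<subseteq> C" if "D \<in> \<D>" for D
    using boxes[OF that] pq[OF that] closure_box[of "p D" "q D"] by metis
  have open_uD: "open ((*) u ` D)" if "D \<in> \<D>" for D
    using interior_injective_linear_image[OF lin_u inj_u, of D] pq[OF that]
    by (metis interior_open open_box open_interior)
  define \<kappa> where "\<kappa> = 1 / (real n + real T)"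
  have \<kappa>: "\<kappa> > 0" using assms(4) by (simp add: \<kappa>_def)
  define good where "good i w \<longleftrightarrow> (\<forall>x\<in>C. 0 \<le> w x) \<and> set_integrable lebesgue C w \<and>
    (LINT x:C|lebesgue. w x) > 0 \<and> (\<forall>Z. Z \<in> sets lebesgue \<longrightarrow> Z \<subseteq> C \<longrightarrow>
      \<kappa> * (LINT x:C|lebesgue. w x) \<le> (LINT x:Z|lebesgue. w x) \<longrightarrow> \<kappa> * V i C \<le> V i Z)" for i w
  have "\<exists>w. good i w" if "i \<in> {1..n}" for i
    using positive_value_density[OF assms(5)[OF that] C less_imp_le[OF \<kappa>]] unfolding good_def by metis
  then obtain w where w: "\<And>i. i \<in> {1..n} \<Longrightarrow> good i (w i)" by metis
  have w_nonneg: "0 \<le> w i x" if "i \<in> {1..n}" "x \<in> C" for i x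
    using w[OF that(1)] that(2) by (simp add: good_def)
  have w_int: "set_integrable lebesgue C (w i)" and w_pos: "(LINT x:C|lebesgue. w i x) > 0"
    if "i \<in> {1..n}" for i
    using w[OF that] by (simp_all add: good_def)
  have w_val: "\<kappa> * V i C \<le> V i Z" if "i \<in> {1..n}" "Z \<in> sets lebesgue" "Z \<subseteq> C"
    "\<kappa> * (LINT x:C|lebesgue. w i x) \<le> (LINT x:Z|lebesgue. w i x)" for i Z
    using w[OF that(1)] that(2-4) by (simp add: good_def)
  \<comment> \<open>Agent \<open>i\<close> values the part of the rectangle \<open>u * D\<close> with first coordinate at most \<open>t\<close> at \<open>F i D t\<close>.\<close>
  define g where "g i D z = indicator ((*) u ` D) z * w i z" for i D z
  define F where "F i D t = (LINT z|lebesgue. indicator {z. u \<bullet> z \<le> t} z * g i D z)" for i D t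
  have uD_C: "(*) u ` D \<subseteq> C" if "D \<in> \<D>" for D
    using in_C[OF that] pq[OF that] box_subset_cbox by (metis image_mono subset_trans)
  have integ: "set_integrable lebesgue S (w i)" if "i \<in> {1..n}" "S \<in> sets lebesgue" "S \<subseteq> C" for i S
    using set_integrable_subset[OF w_int[OF that(1)] that(2,3)] .
  have uD_meas: "(*) u ` D \<in> sets lebesgue" if "D \<in> \<D>" for D
    using open_uD[OF that] by (simp add: borel_open)
  have g_int: "integrable lebesgue (g i D)" if "i \<in> {1..n}" "D \<in> \<D>" for i D
    using integ[OF that(1) uD_meas[OF that(2)] uD_C[OF that(2)]]
    by (simp add: set_integrable_def g_def[abs_def])
  have g_nonneg: "g i D z \<ge> 0" if "i \<in> {1..n}" "D \<in> \<D>" for i D z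
    using w_nonneg[OF that(1), of z] uD_C[OF that(2)] by (auto simp: g_def indicator_def)
  have slab: "{z. u \<bullet> z \<le> t} \<in> sets lebesgue" for t
    using closed_halfspace_le[of u t] by (simp add: borel_closed)
  have gs_int: "integrable lebesgue (\<lambda>z. indicator {z. u \<bullet> z \<le> t} z * g i D z)"
    if "i \<in> {1..n}" "D \<in> \<D>" for i D t
    using integrable_mult_indicator[OF slab g_int[OF that]] by simp
  have diff: "F i D t - F i D s = (LINT z|lebesgue. (indicator {z. u \<bullet> z \<le> t} z - indicator {z. u \<bullet> z \<le> s} z) * g i D z)"
    if "i \<in> {1..n}" "D \<in> \<D>" for i D s t
    unfolding F_def left_diff_distrib using gs_int[OF that] by (simp add: Bochner_Integration.integral_diff)
  have whole: "F i D (Re (q D)) - F i D (Re (p D)) = (LINT z|lebesgue. g i D z)"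
    if "i \<in> {1..n}" "D \<in> \<D>" for i D
    unfolding diff[OF that]
  proof (rule Bochner_Integration.integral_cong[OF refl])
    fix z
    show "(indicator {z. u \<bullet> z \<le> Re (q D)} z - indicator {z. u \<bullet> z \<le> Re (p D)} z) * g i D z = g i D z"
    proof (cases "z \<in> (*) u ` D")
      case True
      then obtain y where "y \<in> D" "z = u * y" by blast
      then have "y \<in> box (p D) (q D)" using pq[OF that(2)] by simp
      then have "Re (p D) < u \<bullet> z" "u \<bullet> z < Re (q D)"
        using \<open>z = u * y\<close> by (auto simp: inner_u in_box_complex_iff)
      then show ?thesis by simp
    qed (simp add: g_def)
  qed
  have total: "(\<Sum>D\<in>\<D>. F i D (Re (q D)) - F i D (Re (p D))) = (LINT z:C|lebesgue. w i z)"
    if i: "i \<in> {1..n}" for i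
  proof -
    have "(\<Sum>D\<in>\<D>. F i D (Re (q D)) - F i D (Re (p D))) = (\<Sum>D\<in>\<D>. LINT z|lebesgue. g i D z)"
      using whole[OF i] by simp
    also have "\<dots> = (LINT z|lebesgue. (\<Sum>D\<in>\<D>. g i D z))"
      using g_int[OF i] by (simp add: Bochner_Integration.integral_sum)
    also have "\<dots> = (LINT z|lebesgue. indicator C z *\<^sub>R w i z)"
    proof (rule integral_cong_AE)
      show "(\<lambda>z. \<Sum>D\<in>\<D>. g i D z) \<in> borel_measurable lebesgue"
        using g_int[OF i] by (intro borel_measurable_sum) auto
      show "(\<lambda>z. indicator C z *\<^sub>R w i z) \<in> borel_measurable lebesgue"
        using w_int[OF i] by (auto simp: set_integrable_def)
      have "AE z in lebesgue. z \<notin> C - (*) u ` \<Union>\<D>"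
        using rest by (intro AE_not_in) (simp add: negligible_iff_null_sets)
      then show "AE z in lebesgue. (\<Sum>D\<in>\<D>. g i D z) = indicator C z *\<^sub>R w i z"
      proof (rule AE_mp, intro AE_I2 impI)
        fix z assume z: "z \<notin> C - (*) u ` \<Union>\<D>"
        have "disjoint_family_on (\<lambda>D. (*) u ` D) \<D>" unfolding disjoint_family_on_def
        proof (intro ballI impI)
          fix D D' assume "D \<in> \<D>" "D' \<in> \<D>" "D \<noteq> D'"
          then have "D \<inter> D' = {}" using \<D>(3) by (simp add: disjointD)
          then show "(*) u ` D \<inter> (*) u ` D' = {}" using image_Int[OF inj_u, of D D'] by simp
        qed
        then have "(\<Sum>D\<in>\<D>. indicator ((*) u ` D) z) = (indicator (\<Union>D\<in>\<D>. (*) u ` D) z :: real)"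
          using indicator_UN_disjoint[OF \<D>(1)] by (metis (no_types, lifting) sum.cong)
        also have "\<dots> = indicator C z"
          using z uD_C by (auto simp: indicator_def)
        finally show "(\<Sum>D\<in>\<D>. g i D z) = indicator C z *\<^sub>R w i z"
          by (simp add: g_def sum_distrib_right[symmetric])
      qed
    qed
    finally show ?thesis by (simp add: set_lebesgue_integral_def)
  qed
  have "\<exists>c s t. (\<forall>i\<in>{1..n}. c i \<in> \<D> \<and> Re (p (c i)) \<le> s i \<and> s i < t i \<and> t i \<le> Re (q (c i)) \<and>
             F i (c i) (t i) - F i (c i) (s i) \<ge> \<kappa> * (LINT z:C|lebesgue. w i z)) \<and>
           (\<forall>i\<in>{1..n}. \<forall>i'\<in>{1..n}. i \<noteq> i' \<longrightarrow> c i = c i' \<longrightarrow> t i \<le> s i' \<or> t i' \<le> s i)"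
  proof (rule multicake_division)
    show "finite {1..n}" "finite \<D>" "\<D> \<noteq> {}" using \<D> by auto
    show "Re (p D) \<le> Re (q D)" if "D \<in> \<D>" for D using lt[OF that] by simp
    fix i assume i: "i \<in> {1..n}"
    show "\<kappa> * (LINT z:C|lebesgue. w i z) > 0" using w_pos[OF i] \<kappa> by simp
    have "(real n + real (card \<D>) - 1) * \<kappa> \<le> (real n + real T) * \<kappa>"
      using \<D>(4) \<kappa> by (intro mult_right_mono) auto
    also have "\<dots> = 1" using assms(4) by (simp add: \<kappa>_def)
    finally have "(real n + real (card \<D>) - 1) * \<kappa> * (LINT z:C|lebesgue. w i z) \<le> 1 * (LINT z:C|lebesgue. w i z)"
      using w_pos[OF i] by (intro mult_right_mono) auto
    then show "(real (card {1..n}) + real (card \<D>) - 1) * (\<kappa> * (LINT z:C|lebesgue. w i z))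
        \<le> (\<Sum>D\<in>\<D>. F i D (Re (q D)) - F i D (Re (p D)))"
      unfolding total[OF i] by (simp add: mult.assoc)
    fix D assume D: "D \<in> \<D>"
    show "continuous_on UNIV (F i D)"
      unfolding F_def by (rule value_up_to_hyperplane_continuous[OF g_int[OF i D] u0])
    show "mono (F i D)"
    proof (rule monoI)
      fix s t :: real assume "s \<le> t"
      then show "F i D s \<le> F i D t" unfolding F_def
        using gs_int[OF i D] g_nonneg[OF i D] by (intro integral_mono) (auto simp: indicator_def)
    qed
  qed
  then obtain c s t where cst:
    "(\<forall>i\<in>{1..n}. c i \<in> \<D> \<and> Re (p (c i)) \<le> s i \<and> s i < t i \<and> t i \<le> Re (q (c i)) \<and>
             F i (c i) (t i) - F i (c i) (s i) \<ge> \<kappa> * (LINT z:C|lebesgue. w i z)) \<and>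
     (\<forall>i\<in>{1..n}. \<forall>i'\<in>{1..n}. i \<noteq> i' \<longrightarrow> c i = c i' \<longrightarrow> t i \<le> s i' \<or> t i' \<le> s i)"
    by (elim exE)
  note c = cst[THEN conjunct1, rule_format] and apart = cst[THEN conjunct2, rule_format]
  define P where "P i = Complex (s i) (Im (p (c i)))" for i
  define Q where "Q i = Complex (t i) (Im (q (c i)))" for i
  define Z where "Z i = (*) u ` cbox (P i) (Q i)" for i
  have sub: "cbox (P i) (Q i) \<subseteq> cbox (p (c i)) (q (c i))" "box (P i) (Q i) \<subseteq> c i" if "i \<in> {1..n}" for i
  proof -
    show "cbox (P i) (Q i) \<subseteq> cbox (p (c i)) (q (c i))"
      using c[OF that] by (auto simp: P_def Q_def in_cbox_complex_iff)
    have "box (P i) (Q i) \<subseteq> box (p (c i)) (q (c i))"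
      using c[OF that] by (auto simp: P_def Q_def in_box_complex_iff)
    then show "box (P i) (Q i) \<subseteq> c i" using pq[of "c i"] c[OF that] by simp
  qed
  have Z_C: "Z i \<subseteq> C" if "i \<in> {1..n}" for i
    using sub(1)[OF that] in_C[of "c i"] c[OF that] unfolding Z_def by blast
  have int_Z: "interior (Z i) = (*) u ` box (P i) (Q i)" for i
    unfolding Z_def using interior_injective_linear_image[OF lin_u inj_u] by simp
  show ?thesis
  proof (intro exI[of _ Z] conjI ballI impI)
    fix i assume i: "i \<in> {1..n}"
    show "rectangle (Z i)" unfolding Z_def
      using c[OF i] lt[of "c i"] by (intro rectangle_rotated_cbox u) (auto simp: P_def Q_def)
    show "Z i \<subseteq> C" by (rule Z_C[OF i])
    have Z_meas: "Z i \<in> sets lebesgue"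
      unfolding Z_def by (intro fmeasurableD lmeasurable_compact compact_continuous_image continuous_intros) simp
    have "\<kappa> * (LINT z:C|lebesgue. w i z) \<le> F i (c i) (t i) - F i (c i) (s i)"
      using c[OF i] by blast
    also have "\<dots> \<le> (LINT z:Z i|lebesgue. w i z)"
      unfolding diff[OF i c[OF i, THEN conjunct1]] set_lebesgue_integral_def
    proof (rule integral_mono)
      show "integrable lebesgue (\<lambda>z. (indicator {z. u \<bullet> z \<le> t i} z - indicator {z. u \<bullet> z \<le> s i} z) * g i (c i) z)"
        unfolding left_diff_distrib using gs_int[OF i c[OF i, THEN conjunct1]]
        by (intro Bochner_Integration.integrable_diff)
      show "integrable lebesgue (\<lambda>z. indicator (Z i) z *\<^sub>R w i z)"
        using integ[OF i Z_meas Z_C[OF i]] by (simp add: set_integrable_def)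
      fix z
      show "(indicator {z. u \<bullet> z \<le> t i} z - indicator {z. u \<bullet> z \<le> s i} z) * g i (c i) z
          \<le> indicator (Z i) z *\<^sub>R w i z"
      proof (cases "z \<in> (*) u ` c i \<and> s i < u \<bullet> z \<and> u \<bullet> z \<le> t i")
        case True
        then obtain y where y: "y \<in> c i" "z = u * y" by blast
        then have "y \<in> box (p (c i)) (q (c i))" using pq[of "c i"] c[OF i] by simp
        then have "y \<in> cbox (P i) (Q i)"
          using True y by (auto simp: P_def Q_def inner_u in_box_complex_iff in_cbox_complex_iff)
        then have "z \<in> Z i" using y by (auto simp: Z_def)
        then show ?thesis using True by (simp add: g_def)
      next
        case False
        then have "(indicator {z. u \<bullet> z \<le> t i} z - indicator {z. u \<bullet> z \<le> s i} z) * g i (c i) z = 0"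
          using c[OF i] by (auto simp: g_def indicator_def)
        moreover have "indicator (Z i) z *\<^sub>R w i z \<ge> 0"
          using w_nonneg[OF i, of z] Z_C[OF i] by (auto simp: indicator_def)
        ultimately show ?thesis by (rule ord_eq_le_trans)
      qed
    qed
    finally have "\<kappa> * V i C \<le> V i (Z i)" by (rule w_val[OF i Z_meas Z_C[OF i]])
    then show "1 / (real n + real T) * V i C \<le> V i (Z i)" by (simp add: \<kappa>_def)
    fix j assume j: "j \<in> {1..n}" "i \<noteq> j"
    have "box (P i) (Q i) \<inter> box (P j) (Q j) = {}"
    proof (cases "c i = c j")
      case True
      then show ?thesis using apart[OF i j(1) j(2)] by (auto simp: P_def Q_def in_box_complex_iff)
    next
      case False
      then have "c i \<inter> c j = {}" using c[OF i] c[OF j(1)] \<D>(3) by (simp add: disjointD)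
      then show ?thesis using sub(2)[OF i] sub(2)[OF j(1)] by blast
    qed
    then show "interior (Z i) \<inter> interior (Z j) = {}"
      unfolding int_Z by (metis image_Int[OF inj_u] image_empty)
  qed
qed

end
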